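(* Suppose $\kappa\ge\max\{\tfrac32 m-1,\,2\}$ and $\|U^0\|_{\mathcal X}\le\sqrt m$. For fixed terminal time $T>0$, assume that the exact solution $U$ of $$U_t+\kappa U=\mathcal L U+\mathcal N[U],\quad t\in(0,T],\ \mathbf x\in\Omega,\qquad U|_{t=0}=U^0,$$ with the periodic boundary condition, belongs to $C^2([0,T];\mathcal X)$, and let $\{U^n\}_{n\ge0}$ be generated by the ETDRK2 scheme $$\widetilde U^{n+1}=e^{(\mathcal L-\kappa)\tau}U^n+\int_0^\tau e^{(\mathcal L-\kappa)(\tau-s)}\mathcal N[U^n]\,ds,$$ $$U^{n+1}=e^{(\mathcal L-\kappa)\tau}U^n+\int_0^\tau e^{(\mathcal L-\kappa)(\tau-s)}\Big(\big(1-\tfrac s\tau\big)\mathcal N[U^n]+\tfrac s\tau\,\mathcal N[\widetilde U^{n+1}]\Big)ds,\qquad n\ge0.$$ Then $$\|U^n-U(t_n)\|_{\mathcal X}\le\tilde C\,e^{(1+5m)t_n}\,\tau^2$$ for every $\tau>0$ and every $n\ge0$ with $t_n=n\tau\le T$, where the constant $\tilde C$ depends on $\kappa$, $m$, $t_n$ and the $C^2([0,T];\mathcal X)$-norm of $U$, but is independent of $\tau$.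
   Context: Let $m\ge2$ be an integer, $\Omega=[-\frac12,\frac12]^m$, $\varepsilon>0$ and $\kappa>0$ constants. $\|\cdot\|_F$ is the Frobenius norm on $\mathbb R^{m\times m}$. $\mathcal X$ is the Banach space of continuous $\mathbb R^{m\times m}$-valued functions on $\overline\Omega$ satisfying the periodic boundary condition (i.e. whose periodic extension to $\mathbb R^m$ is continuous), with norm $\|W\|_{\mathcal X}=\max_{\mathbf x\in\overline\Omega}\|W(\mathbf x)\|_F$. $\mathcal L=\varepsilon^2\Delta$ with periodic boundary condition, acting entrywise; $e^{t\mathcal L}=e^{t\varepsilon^2\Delta}$ ($t\ge0$) is the periodic heat semigroup on $\mathcal X$, acting entrywise, and $e^{(\mathcal L-\kappa)t}=e^{-\kappa t}e^{t\mathcal L}$. The nonlinearity acts pointwise: $\mathcal N[U]=\kappa U+f(U)$ with $f(U)=U-UU^{\mathrm T}U$. The exact solution is the unique $U\in C([0,T];\mathcal X)$ with $\|U(t)\|_{\mathcal X}\le\sqrt m$ for all $t\in[0,T]$ satisfying $U(t)=e^{t(\mathcal L-\kappa)}U^0+\int_0^te^{(t-s)(\mathcal L-\kappa)}\mathcal N[U(s)]\,ds$ for all $t\in[0,T]$. The $C^2([0,T];\mathcal X)$-norm is the usual one, $\sum_{k=0}^2\max_{t\in[0,T]}\|U^{(k)}(t)\|_{\mathcal X}$. *)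

theory Defs
  imports "HOL-Analysis.Analysis"
begin

section \<open>The Banach space of periodic continuous matrix fields\<close>

definition cell :: "(real ^ 'n) set"
  where "cell = cbox (\<chi> i. - 1 / 2) (\<chi> i. 1 / 2)"

text \<open>
  A function on the closed cell satisfying the periodic boundary condition is identified with its
  1-periodic extension to the whole space. The norm is still the maximum over the cell, and the
  library norm on matrices \<^typ>\<open>real ^ 'n ^ 'n\<close> is the Frobenius norm (the Euclidean norm of the
  Euclidean norms of the rows).
\<close>

typedef 'n per_field =
  "{W :: real ^ 'n::finite \<Rightarrow> real ^ 'n ^ 'n.
      continuous_on UNIV W \<and> (\<forall>x k. (\<forall>i. k $ i \<in> \<int>) \<longrightarrow> W (x + k) = W x)}"
  morphisms at_point Per_field
  by (rule exI[of _ "\<lambda>_. 0"]) auto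

setup_lifting type_definition_per_field

lemma continuous_at_point: "continuous_on A (at_point W)"
  using at_point[of W] by (auto intro: continuous_on_subset)

lemma at_point_periodic: "(\<And>i. k $ i \<in> \<int>) \<Longrightarrow> at_point W (x + k) = at_point W x"
  using at_point[of W] by auto

lemma per_field_eqI: "(\<And>x. at_point V x = at_point W x) \<Longrightarrow> V = W"
  by (simp add: at_point_inject[symmetric] fun_eq_iff)

lemma cell_representative:
  fixes x :: "real ^ 'n::finite"
  obtains y where "y \<in> cell" and "\<And>W. at_point W x = at_point W y"
proof
  define k :: "real ^ 'n" where "k = (\<chi> i. - of_int (round (x $ i)))"
  have "\<bar>x $ i + k $ i\<bar> \<le> 1 / 2" for i
    using of_int_round_abs_le[of "x $ i"] by (simp add: k_def abs_minus_commute)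
  then have "- (1 / 2) \<le> x $ i + k $ i" and "x $ i + k $ i \<le> 1 / 2" for i
    by (simp_all only: abs_le_iff minus_le_iff[of _ "1 / 2"])
  then show "x + k \<in> cell"
    by (simp add: cell_def mem_box_cart)
  show "at_point W x = at_point W (x + k)" for W
    by (rule at_point_periodic[symmetric]) (simp add: k_def)
qed

lemma bdd_above_norm_cell: "bdd_above ((\<lambda>x. norm (at_point W x)) ` cell)"
  unfolding cell_def
  by (intro bounded_imp_bdd_above compact_imp_bounded compact_continuous_image
      continuous_on_norm continuous_at_point compact_cbox)

lemma cell_nonempty: "cell \<noteq> {}"
  using cell_representative[of 0] by blast

instantiation per_field :: (finite) real_vector
begin

lift_definition zero_per_field :: "'a per_field" is "\<lambda>_. 0" by simp
lift_definition uminus_per_field :: "'a per_field \<Rightarrow> 'a per_field" is "\<lambda>V x. - V x"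
  by (simp add: continuous_on_minus)
lift_definition plus_per_field :: "'a per_field \<Rightarrow> 'a per_field \<Rightarrow> 'a per_field"
  is "\<lambda>V W x. V x + W x" by (simp add: continuous_on_add)
lift_definition minus_per_field :: "'a per_field \<Rightarrow> 'a per_field \<Rightarrow> 'a per_field"
  is "\<lambda>V W x. V x - W x" by (simp add: continuous_on_diff)
lift_definition scaleR_per_field :: "real \<Rightarrow> 'a per_field \<Rightarrow> 'a per_field"
  is "\<lambda>r W x. r *\<^sub>R W x" by (simp add: continuous_on_scaleR)

instance
  by standard (transfer; simp add: fun_eq_iff algebra_simps)+

end

lemmas at_point_simps [simp] =
  zero_per_field.rep_eq uminus_per_field.rep_eq plus_per_field.rep_eq
  minus_per_field.rep_eq scaleR_per_field.rep_eq

instantiation per_field :: (finite) real_normed_vector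
begin

definition norm_per_field :: "'a per_field \<Rightarrow> real"
  where "norm_per_field W = (SUP x\<in>cell. norm (at_point W x))"

definition dist_per_field :: "'a per_field \<Rightarrow> 'a per_field \<Rightarrow> real"
  where "dist_per_field V W = norm (V - W)"

definition sgn_per_field :: "'a per_field \<Rightarrow> 'a per_field"
  where "sgn_per_field W = W /\<^sub>R norm W"

definition uniformity_per_field :: "('a per_field \<times> 'a per_field) filter"
  where "uniformity_per_field = (INF e\<in>{0 <..}. principal {(x, y). dist x y < e})"

definition open_per_field :: "'a per_field set \<Rightarrow> bool"
  where "open_per_field S = (\<forall>x\<in>S. \<forall>\<^sub>F (x', y) in uniformity. x' = x \<longrightarrow> y \<in> S)"

lemma norm_at_point_le: "norm (at_point W x) \<le> norm W" for W :: "'a per_field"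
proof -
  obtain y where "y \<in> cell" "at_point W x = at_point W y"
    by (metis cell_representative)
  then show ?thesis
    unfolding norm_per_field_def
    using cSUP_upper[OF _ bdd_above_norm_cell, of y W] by simp
qed

lemma norm_per_field_le:
  "(\<And>x. norm (at_point W x) \<le> b) \<Longrightarrow> norm W \<le> b" for W :: "'a per_field"
  unfolding norm_per_field_def by (rule cSUP_least[OF cell_nonempty])

instance
proof
  fix V W :: "'a per_field" and r :: real
  show "norm W = 0 \<longleftrightarrow> W = 0"
  proof
    assume "norm W = 0"
    then show "W = 0"
      using norm_at_point_le[of W] by (intro per_field_eqI) simp
  next
    assume "W = 0"
    then show "norm W = 0"
      unfolding norm_per_field_def by (simp add: cell_nonempty)
  qed
  show "norm (V + W) \<le> norm V + norm W"
    by (rule norm_per_field_le)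
       (simp add: norm_triangle_mono norm_at_point_le)
  have scale_le: "norm (c *\<^sub>R X) \<le> \<bar>c\<bar> * norm X" for c and X :: "'a per_field"
    by (rule norm_per_field_le) (simp add: mult_left_mono norm_at_point_le)
  show "norm (r *\<^sub>R W) = \<bar>r\<bar> * norm W"
  proof (cases "r = 0")
    case True
    then show ?thesis
      unfolding norm_per_field_def by (simp add: cell_nonempty)
  next
    case False
    have "\<bar>r\<bar> * norm W = \<bar>r\<bar> * norm (inverse r *\<^sub>R (r *\<^sub>R W))"
      using False by simp
    also have "\<dots> \<le> \<bar>r\<bar> * (\<bar>inverse r\<bar> * norm (r *\<^sub>R W))"
      by (intro mult_left_mono scale_le) simp
    also have "\<dots> = norm (r *\<^sub>R W)"
      using False by (simp add: abs_inverse)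
    finally show ?thesis
      using scale_le[of r W] by simp
  qed
qed (simp_all add: dist_per_field_def sgn_per_field_def uniformity_per_field_def
      open_per_field_def)

end

instance per_field :: (finite) banach
proof
  fix X :: "nat \<Rightarrow> 'a per_field"
  assume "Cauchy X"
  have dist_le: "dist (at_point V x) (at_point W x) \<le> dist V W" for V W :: "'a per_field" and x
    using norm_at_point_le[of "V - W" x] by (simp add: dist_norm)
  have "\<forall>e>0. \<exists>N. \<forall>m n x. N \<le> m \<and> N \<le> n \<and> True \<longrightarrow>
      dist (at_point (X m) x) (at_point (X n) x) < e"
    using \<open>Cauchy X\<close> dist_le unfolding Cauchy_def by (metis le_less_trans)
  then obtain g where g: "\<forall>e>0. \<exists>N. \<forall>n x. N \<le> n \<and> True \<longrightarrow> dist (at_point (X n) x) (g x) < e"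
    using uniformly_convergent_eq_cauchy[of "\<lambda>_. True" "\<lambda>n x. at_point (X n) x"] by blast
  then have lim: "uniform_limit UNIV (\<lambda>n. at_point (X n)) g sequentially"
    unfolding uniform_limit_sequentially_iff by auto
  have cont: "continuous_on UNIV g"
    by (rule uniform_limit_theorem[OF _ lim]) (simp_all add: continuous_at_point)
  have per: "g (x + k) = g x" if "\<forall>i. k $ i \<in> \<int>" for x k
  proof (rule LIMSEQ_unique)
    show "(\<lambda>n. at_point (X n) x) \<longlonglongrightarrow> g x"
      by (rule tendsto_uniform_limitI[OF lim]) simp
    have "(\<lambda>n. at_point (X n) (x + k)) \<longlonglongrightarrow> g (x + k)"
      by (rule tendsto_uniform_limitI[OF lim]) simp
    then show "(\<lambda>n. at_point (X n) x) \<longlonglongrightarrow> g (x + k)"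
      using that by (simp add: at_point_periodic)
  qed
  define G where "G = Per_field g"
  have G: "at_point G = g"
    unfolding G_def using cont per by (intro Per_field_inverse) auto
  have "X \<longlonglongrightarrow> G"
  proof (rule LIMSEQ_I)
    fix e :: real assume "0 < e"
    then obtain N where N: "\<And>n x. N \<le> n \<Longrightarrow> dist (at_point (X n) x) (g x) < e / 2"
      using g by (meson half_gt_zero)
    have "norm (X n - G) < e" if "N \<le> n" for n
    proof -
      have "norm (X n - G) \<le> e / 2"
        using N[OF that] by (intro norm_per_field_le) (simp add: G dist_norm less_imp_le)
      with \<open>0 < e\<close> show ?thesis by simp
    qed
    then show "\<exists>N. \<forall>n\<ge>N. norm (X n - G) < e" by blast
  qed
  then show "convergent X" by (rule convergentI)
qed


section \<open>The periodic Laplacian and its semigroup\<close>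

definition has_partial :: "'n::finite \<Rightarrow> 'n per_field \<Rightarrow> 'n per_field \<Rightarrow> bool"
  where "has_partial i W V \<longleftrightarrow>
    (\<forall>x. ((\<lambda>h. at_point W (x + h *\<^sub>R axis i 1)) has_vector_derivative at_point V x) (at 0))"

text \<open>
  The graph of the classical Laplacian, acting entrywise on the periodic fields of class $C^2$:
  all partial derivatives up to order two exist and are continuous (and then periodic).
\<close>

definition laplacian :: "('n::finite per_field \<times> 'n per_field) set"
  where "laplacian = {(W, V). \<exists>D D2. (\<forall>i. has_partial i W (D i)) \<and>
    (\<forall>i j. has_partial j (D i) (D2 i j)) \<and> V = (\<Sum>i\<in>UNIV. D2 i i)}"

definition C0_semigroup :: "(real \<Rightarrow> 'a \<Rightarrow> 'a::real_normed_vector) \<Rightarrow> bool"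
  where "C0_semigroup S \<longleftrightarrow>
    (\<forall>t\<ge>0. bounded_linear (S t)) \<and>
    S 0 = id \<and>
    (\<forall>s\<ge>0. \<forall>t\<ge>0. S (s + t) = S s \<circ> S t) \<and>
    (\<forall>x. ((\<lambda>t. S t x) \<longlongrightarrow> x) (at_right 0))"

definition generator :: "(real \<Rightarrow> 'a \<Rightarrow> 'a::real_normed_vector) \<Rightarrow> ('a \<times> 'a) set"
  where "generator S = {(x, y). ((\<lambda>t. (1 / t) *\<^sub>R (S t x - x)) \<longlongrightarrow> y) (at_right 0)}"

text \<open>
  \<open>S\<close> is the semigroup $e^{t\varepsilon^2\Delta}$, that is, the strongly continuous semigroup generated
  by $\varepsilon^2\Delta$ with periodic boundary condition. In the maximum norm the classical
  operator with domain $C^2$ is not closed; the generator is its closure. A strongly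
  continuous semigroup is determined by its generator for \<open>t \<ge> 0\<close>; values of \<open>S\<close> at negative
  times are never used.
\<close>

definition heat_semigroup :: "real \<Rightarrow> (real \<Rightarrow> 'n::finite per_field \<Rightarrow> 'n per_field) \<Rightarrow> bool"
  where "heat_semigroup \<epsilon> S \<longleftrightarrow>
    C0_semigroup S \<and> generator S = closure {(W, \<epsilon>\<^sup>2 *\<^sub>R V) | W V. (W, V) \<in> laplacian}"

text \<open>$e^{(\mathcal L-\kappa)t}$, where \<open>S t\<close> is $e^{t\mathcal L}$.\<close>

definition damped :: "real \<Rightarrow> (real \<Rightarrow> 'a \<Rightarrow> 'a::real_vector) \<Rightarrow> real \<Rightarrow> 'a \<Rightarrow> 'a"
  where "damped \<kappa> S t W = exp (- \<kappa> * t) *\<^sub>R S t W"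


section \<open>The nonlinearity\<close>

definition reaction :: "real ^ 'n ^ 'n \<Rightarrow> real ^ 'n ^ 'n"
  where "reaction A = A - A ** transpose A ** A"

lemma continuous_on_reaction:
  "continuous_on A W \<Longrightarrow> continuous_on A (\<lambda>x. reaction (W x :: real ^ 'n::finite ^ 'n))"
  unfolding reaction_def matrix_matrix_mult_def transpose_def
  by (intro continuous_intros) simp_all

lift_definition nonlin :: "real \<Rightarrow> 'n::finite per_field \<Rightarrow> 'n per_field"
  is "\<lambda>\<kappa> W x. \<kappa> *\<^sub>R W x + reaction (W x)"
  by (auto intro!: continuous_on_add continuous_on_scaleR continuous_on_reaction)


section \<open>Exact solution and time regularity\<close>

definition exact_solution :: "real \<Rightarrow> (real \<Rightarrow> 'n::finite per_field \<Rightarrow> 'n per_field) \<Rightarrow> real \<Rightarrow>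
    'n per_field \<Rightarrow> (real \<Rightarrow> 'n per_field) \<Rightarrow> bool"
  where "exact_solution \<kappa> S T U0 U \<longleftrightarrow>
    continuous_on {0..T} U \<and>
    (\<forall>t\<in>{0..T}. norm (U t) \<le> sqrt (real CARD('n))) \<and>
    (\<forall>t\<in>{0..T}. U t = damped \<kappa> S t U0 +
        integral {0..t} (\<lambda>s. damped \<kappa> S (t - s) (nonlin \<kappa> (U s))))"

definition time_deriv :: "real \<Rightarrow> (real \<Rightarrow> 'a::real_normed_vector) \<Rightarrow> real \<Rightarrow> 'a"
  where "time_deriv T U t = vector_derivative U (at t within {0..T})"

definition C2_in_time :: "real \<Rightarrow> (real \<Rightarrow> 'a::real_normed_vector) \<Rightarrow> bool"
  where "C2_in_time T U \<longleftrightarrow>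
    (\<forall>k<2. \<forall>t\<in>{0..T}. ((time_deriv T ^^ k) U) differentiable (at t within {0..T})) \<and>
    continuous_on {0..T} ((time_deriv T ^^ 2) U)"

definition C2_norm :: "real \<Rightarrow> (real \<Rightarrow> 'a::real_normed_vector) \<Rightarrow> real"
  where "C2_norm T U = (\<Sum>k\<le>2. SUP t\<in>{0..T}. norm ((time_deriv T ^^ k) U t))"


section \<open>The ETDRK2 scheme\<close>

definition etd_predictor :: "real \<Rightarrow> (real \<Rightarrow> 'n::finite per_field \<Rightarrow> 'n per_field) \<Rightarrow> real \<Rightarrow>
    'n per_field \<Rightarrow> 'n per_field"
  where "etd_predictor \<kappa> S \<tau> V = damped \<kappa> S \<tau> V +
    integral {0..\<tau>} (\<lambda>s. damped \<kappa> S (\<tau> - s) (nonlin \<kappa> V))"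

definition etdrk2_step :: "real \<Rightarrow> (real \<Rightarrow> 'n::finite per_field \<Rightarrow> 'n per_field) \<Rightarrow> real \<Rightarrow>
    'n per_field \<Rightarrow> 'n per_field"
  where "etdrk2_step \<kappa> S \<tau> V = damped \<kappa> S \<tau> V +
    integral {0..\<tau>} (\<lambda>s. damped \<kappa> S (\<tau> - s)
      ((1 - s / \<tau>) *\<^sub>R nonlin \<kappa> V + (s / \<tau>) *\<^sub>R nonlin \<kappa> (etd_predictor \<kappa> S \<tau> V)))"

primrec etdrk2 :: "real \<Rightarrow> (real \<Rightarrow> 'n::finite per_field \<Rightarrow> 'n per_field) \<Rightarrow> real \<Rightarrow>
    'n per_field \<Rightarrow> nat \<Rightarrow> 'n per_field"
  where
    "etdrk2 \<kappa> S \<tau> U0 0 = U0"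
  | "etdrk2 \<kappa> S \<tau> U0 (Suc n) = etdrk2_step \<kappa> S \<tau> (etdrk2 \<kappa> S \<tau> U0 n)"

end

theory Submission
  imports Defs
begin

text \<open>
  Write \<open>m\<close> for the size of the matrices, \<open>D t\<close> for the damped semigroup $e^{(\mathcal L-\kappa)t}$,
  \<open>N\<close> for the nonlinearity and \<open>a = 1 + 3 m\<close>. The proof compares one step of the scheme with the
  exact solution restarted at the same time, and rests on three facts.

  The heat semigroup is a contraction in the maximum norm (\<open>contraction\<close>). It is known only through
  its generator, the closure of the classical Laplacian. At a point where the Frobenius norm of a
  $C^2$ field \<open>W\<close> is largest, the second derivative test gives a nonpositive inner product of \<open>W\<close>
  with its Laplacian; hence the generator is dissipative (\<open>generator_dissipative\<close>), and a strongly
  continuous semigroup with dissipative generator is contractive. So \<open>D t\<close> has norm at most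
  $e^{-\kappa t}$.

  The closed ball of radius $\sqrt m$ is mapped by \<open>N\<close> into the ball of radius $\kappa\sqrt m$
  (\<open>norm_nonlin_le\<close>), so that the predictor and every step of the scheme stay in the former ball: its
  radius is reproduced by $e^{-\kappa\tau}\sqrt m+\kappa\sqrt m\int_0^\tau e^{-\kappa s}\,ds=\sqrt m$.
  On this ball \<open>N\<close> is Lipschitz with constant \<open>L = \<kappa> + a\<close> (\<open>norm_nonlin_diff_le\<close>).

  The solution is $C^2$ in time and \<open>N\<close> is a cubic polynomial, so replacing \<open>N (U (t + s))\<close> by the
  linear interpolant of its values at both ends of a step costs $O(\tau^2)$; the predictor is also
  accurate to $O(\tau^2)$. Integrating over a step gives a local error $O(\tau^3)$, with constants that
  involve only \<open>\<kappa>\<close>, \<open>m\<close> and the $C^2$ norm.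

  The point that requires care is the amplification of earlier errors, since the bound must not
  contain $e^{L\tau}$ with its dependence on \<open>\<kappa>\<close>. The part \<open>\<kappa>\<close> of the Lipschitz constant is exactly
  compensated by the damping, and one step multiplies the error by at most
  $1+a\tau+(a\tau)^2/2\le e^{a\tau}$ (\<open>one_step_error\<close>). Summing \<open>n\<close> local errors of size $c\tau^3$
  then gives $n\tau\,c\,e^{a n\tau}\tau^2$ (\<open>global_error\<close>), and \<open>a \<le> 1 + 5 m\<close>.
\<close>

section \<open>Frobenius geometry of the nonlinearity\<close>

lemma bounded_bilinear_matrix_mult:
  "bounded_bilinear ((**) :: real ^ 'n ^ 'm \<Rightarrow> real ^ 'p ^ 'n \<Rightarrow> real ^ 'p ^ 'm)"
  by (rule bilinear_conv_bounded_bilinear[THEN iffD1])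
    (auto simp: bilinear_def linear_iff matrix_add_ldistrib matrix_matrix_mult_def vec_eq_iff
      sum.distrib algebra_simps sum_distrib_left)

lemma matrix_mult_adjoint:
  fixes A :: "real ^ 'n ^ 'm" and X :: "real ^ 'p ^ 'n" and Y :: "real ^ 'p ^ 'm"
  shows "(A ** X) \<bullet> Y = X \<bullet> (transpose A ** Y)"
proof -
  have "(A ** X) \<bullet> Y = (\<Sum>i\<in>UNIV. \<Sum>j\<in>UNIV. \<Sum>k\<in>UNIV. A $ i $ k * X $ k $ j * Y $ i $ j)"
    by (simp add: inner_vec_def matrix_matrix_mult_def sum_distrib_right)
  also have "\<dots> = (\<Sum>i\<in>UNIV. \<Sum>k\<in>UNIV. \<Sum>j\<in>UNIV. A $ i $ k * X $ k $ j * Y $ i $ j)"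
    by (rule sum.cong[OF refl], rule sum.swap)
  also have "\<dots> = (\<Sum>k\<in>UNIV. \<Sum>i\<in>UNIV. \<Sum>j\<in>UNIV. A $ i $ k * X $ k $ j * Y $ i $ j)"
    by (rule sum.swap)
  also have "\<dots> = (\<Sum>k\<in>UNIV. \<Sum>j\<in>UNIV. \<Sum>i\<in>UNIV. A $ i $ k * X $ k $ j * Y $ i $ j)"
    by (rule sum.cong[OF refl], rule sum.swap)
  also have "\<dots> = X \<bullet> (transpose A ** Y)"
    by (simp add: inner_vec_def matrix_matrix_mult_def transpose_def sum_distrib_left mult_ac)
  finally show ?thesis .
qed

lemma norm_matrix_eq: "(norm (A :: real ^ 'n ^ 'm))\<^sup>2 = (\<Sum>i\<in>UNIV. \<Sum>j\<in>UNIV. (A $ i $ j)\<^sup>2)"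
  unfolding power2_norm_eq_inner by (simp add: inner_vec_def power2_eq_square)

lemma norm_transpose: "norm (transpose A :: real ^ 'm ^ 'n) = norm A"
proof -
  have "(norm (transpose A))\<^sup>2 = (norm A)\<^sup>2"
    unfolding norm_matrix_eq transpose_def by (subst sum.swap) simp
  then show ?thesis by simp
qed

text \<open>
  Cauchy--Schwarz for each entry of the product, a row of the first factor against a column of the
  second, followed by summation.
\<close>

lemma norm_matrix_mult_le:
  fixes A :: "real ^ 'n ^ 'm" and B :: "real ^ 'p ^ 'n"
  shows "norm (A ** B) \<le> norm A * norm B"
proof (rule power2_le_imp_le)
  have "(norm (A ** B))\<^sup>2 = (\<Sum>i\<in>UNIV. \<Sum>j\<in>UNIV. (A $ i \<bullet> transpose B $ j)\<^sup>2)"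
    by (simp add: norm_matrix_eq matrix_matrix_mult_def inner_vec_def transpose_def)
  also have "\<dots> \<le> (\<Sum>i\<in>UNIV. \<Sum>j\<in>UNIV. (norm (A $ i))\<^sup>2 * (norm (transpose B $ j))\<^sup>2)"
  proof (intro sum_mono)
    fix i j
    have "\<bar>A $ i \<bullet> transpose B $ j\<bar>\<^sup>2 \<le> (norm (A $ i) * norm (transpose B $ j))\<^sup>2"
      by (intro power_mono Cauchy_Schwarz_ineq2) simp
    then show "(A $ i \<bullet> transpose B $ j)\<^sup>2 \<le> (norm (A $ i))\<^sup>2 * (norm (transpose B $ j))\<^sup>2"
      by (simp add: power_mult_distrib)
  qed
  also have "\<dots> = (norm A)\<^sup>2 * (norm (transpose B))\<^sup>2"
    by (simp add: power2_norm_eq_inner inner_vec_def[of A] inner_vec_def[of "transpose B"]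
        sum_product)
  finally show "(norm (A ** B))\<^sup>2 \<le> (norm A * norm B)\<^sup>2"
    by (simp add: norm_transpose power_mult_distrib)
qed simp

text \<open>
  The trilinear form whose diagonal is the cubic term of the reaction; every estimate of the cubic
  term is an expansion in the three arguments.
\<close>

definition tri :: "real ^ 'n ^ 'n \<Rightarrow> real ^ 'n ^ 'n \<Rightarrow> real ^ 'n ^ 'n \<Rightarrow> real ^ 'n ^ 'n"
  where "tri A B C = A ** transpose B ** C"

lemma transpose_linear:
  "transpose (A + B) = transpose A + transpose (B :: real ^ 'n ^ 'm)"
  "transpose (A - B) = transpose A - transpose (B :: real ^ 'n ^ 'm)"
  "transpose (c *\<^sub>R A) = c *\<^sub>R transpose (A :: real ^ 'n ^ 'm)"
  by (simp_all add: transpose_def vec_eq_iff)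

lemma tri_linear:
  "tri (A + A') B C = tri A B C + tri A' B C" "tri (A - A') B C = tri A B C - tri A' B C"
  "tri A (B + B') C = tri A B C + tri A B' C" "tri A (B - B') C = tri A B C - tri A B' C"
  "tri A B (C + C') = tri A B C + tri A B C'" "tri A B (C - C') = tri A B C - tri A B C'"
  "tri (c *\<^sub>R A) B C = c *\<^sub>R tri A B C" "tri A (c *\<^sub>R B) C = c *\<^sub>R tri A B C"
  "tri A B (c *\<^sub>R C) = c *\<^sub>R tri A B C"
  unfolding tri_def transpose_linear
  by (simp_all add: bounded_bilinear_matrix_mult bounded_bilinear.add_left
      bounded_bilinear.add_right bounded_bilinear.diff_left bounded_bilinear.diff_right
      bounded_bilinear.scaleR_left bounded_bilinear.scaleR_right)

lemma norm_tri_le: "norm (tri A B C) \<le> norm A * norm B * norm C"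
proof -
  have "norm (tri A B C) \<le> norm (A ** transpose B) * norm C"
    unfolding tri_def by (rule norm_matrix_mult_le)
  also have "norm (A ** transpose B) \<le> norm A * norm B"
    using norm_matrix_mult_le[of A "transpose B"] by (simp add: norm_transpose)
  finally show ?thesis by (simp add: mult_right_mono)
qed

lemma norm_tri_le_bounds:
  assumes "norm A \<le> a" "norm B \<le> b" "norm C \<le> c"
  shows "norm (tri A B C) \<le> a * b * c"
proof -
  have "0 \<le> a" "0 \<le> b"
    using assms norm_ge_zero order_trans by blast+
  then have "norm A * norm B * norm C \<le> a * b * c"
    using assms by (intro mult_mono) auto
  then show ?thesis
    using norm_tri_le[of A B C] by linarith
qed

definition nonlin_at :: "real \<Rightarrow> real ^ 'n ^ 'n \<Rightarrow> real ^ 'n ^ 'n"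
  where "nonlin_at \<kappa> A = \<kappa> *\<^sub>R A + reaction A"

lemma nonlin_at_tri: "nonlin_at \<kappa> A = (\<kappa> + 1) *\<^sub>R A - tri A A A"
  by (simp add: nonlin_at_def reaction_def tri_def algebra_simps)

lemma at_point_nonlin: "at_point (nonlin \<kappa> W) x = nonlin_at \<kappa> (at_point W x)"
  by (simp add: nonlin.rep_eq nonlin_at_def)

lemma norm_mat_1: "(norm (mat 1 :: real ^ 'n ^ 'n))\<^sup>2 = real CARD('n)"
proof -
  have "(norm (mat 1 :: real ^ 'n ^ 'n))\<^sup>2 = (\<Sum>i\<in>(UNIV :: 'n set). \<Sum>j\<in>UNIV. if i = j then 1 else 0)"
    unfolding norm_matrix_eq by (rule sum.cong[OF refl], rule sum.cong[OF refl]) (simp add: mat_def)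
  then show ?thesis by simp
qed

text \<open>
  With the singular values $\sigma_i$ of \<open>A\<close> and $s_i=\sigma_i^2$ the claim says
  $\sum_i g(s_i)\le\kappa^2m$ for $g(s)=s(\kappa+1-s)^2$. The tangent of $g$ at $1$ satisfies
  $g(s)-\kappa^2-\kappa(\kappa-2)(s-1)=(s-1)^2(s-2\kappa)\le0$ on the relevant range
  $0\le s\le m\le2\kappa$; summing and using $\sum_is_i\le m$ and $\kappa\ge2$ gives the bound. The
  proof expresses the same computation by traces, without a singular value decomposition: with
  $P=A^{\mathrm T}A$, the sign of $(s-1)^2(s-2\kappa)$ becomes the inequality
  $\|A(P-I)\|^2\le\|A\|^2\|P-I\|^2\le2\kappa\|P-I\|^2$.
\<close>

lemma norm_nonlin_at_le:
  fixes A :: "real ^ 'n ^ 'n"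
  assumes A: "norm A \<le> sqrt (real CARD('n))"
    and \<kappa>: "2 \<le> \<kappa>" "real CARD('n) \<le> 2 * \<kappa>"
  shows "norm (nonlin_at \<kappa> A) \<le> \<kappa> * sqrt (real CARD('n))"
proof (rule power2_le_imp_le)
  define m where "m = real CARD('n)"
  define P where "P = transpose A ** A"
  define B where "B = A ** P"
  define a where "a = (norm A)\<^sup>2"
  define b where "b = A \<bullet> B"
  have a: "a \<le> m"
    using power_mono[OF A, of 2] by (simp add: a_def m_def)
  have tri: "tri A A A = B"
    by (simp add: tri_def B_def P_def matrix_mul_assoc)
  have PP: "(norm P)\<^sup>2 = b"
    unfolding power2_norm_eq_inner b_def B_def using matrix_mult_adjoint[of A P A]
    by (simp add: P_def inner_commute)
  have PI: "P \<bullet> mat 1 = a"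
    unfolding a_def power2_norm_eq_inner using matrix_mult_adjoint[of A "mat 1" A]
    by (simp add: P_def inner_commute)
  \<comment> \<open>the difference on the left is \<open>A ** (P - mat 1)\<close>\<close>
  have "norm (B - A) \<le> norm A * norm (P - mat 1)"
    using norm_matrix_mult_le[of A "P - mat 1"]
    by (simp add: B_def bounded_bilinear.diff_right[OF bounded_bilinear_matrix_mult])
  then have "(norm (B - A))\<^sup>2 \<le> (norm A * norm (P - mat 1))\<^sup>2"
    by (intro power_mono) auto
  then have "(norm (B - A))\<^sup>2 \<le> a * (norm (P - mat 1))\<^sup>2"
    by (simp add: a_def power_mult_distrib)
  also have "\<dots> \<le> 2 * \<kappa> * (norm (P - mat 1))\<^sup>2"
    using a \<kappa>(2) by (intro mult_right_mono) (auto simp: m_def)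
  also have "(norm (P - mat 1))\<^sup>2 = b - 2 * a + m"
    using PP PI norm_mat_1[where 'n = 'n]
    by (simp add: power2_norm_eq_inner inner_diff_left inner_diff_right inner_commute m_def)
  also have "(norm (B - A))\<^sup>2 = (norm B)\<^sup>2 - 2 * b + a"
    by (simp add: power2_norm_eq_inner inner_diff_left inner_diff_right inner_commute a_def b_def)
  finally have B: "(norm B)\<^sup>2 \<le> 2 * b - a + 2 * \<kappa> * (b - 2 * a + m)"
    by simp
  have "(norm (nonlin_at \<kappa> A))\<^sup>2 = (\<kappa> + 1)\<^sup>2 * a - 2 * (\<kappa> + 1) * b + (norm B)\<^sup>2"
    unfolding nonlin_at_tri tri power2_norm_eq_inner a_def b_def
    by (simp add: inner_diff_left inner_diff_right inner_commute algebra_simps power2_eq_square)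
  also have "\<dots> \<le> (\<kappa> + 1)\<^sup>2 * a - 2 * (\<kappa> + 1) * b + (2 * b - a + 2 * \<kappa> * (b - 2 * a + m))"
    using B by simp
  also have "\<dots> = \<kappa> * (\<kappa> - 2) * a + 2 * \<kappa> * m"
    by (simp add: algebra_simps power2_eq_square)
  also have "\<dots> \<le> \<kappa> * (\<kappa> - 2) * m + 2 * \<kappa> * m"
    using a \<kappa> by (intro add_right_mono mult_left_mono) auto
  also have "\<dots> = (\<kappa> * sqrt (real CARD('n)))\<^sup>2"
    by (simp add: m_def power_mult_distrib algebra_simps power2_eq_square)
  finally show "(norm (nonlin_at \<kappa> A))\<^sup>2 \<le> (\<kappa> * sqrt (real CARD('n)))\<^sup>2" .
next
  show "0 \<le> \<kappa> * sqrt (real CARD('n))" using \<kappa> by simp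
qed

text \<open>
  The difference of the cubic terms telescopes into three trilinear terms, each with one argument
  \<open>A - B\<close> and two arguments of norm at most \<open>r\<close>.
\<close>

lemma norm_nonlin_at_diff_le:
  fixes A B :: "real ^ 'n ^ 'n"
  assumes A: "norm A \<le> r" and B: "norm B \<le> r" and "0 \<le> \<kappa>"
  shows "norm (nonlin_at \<kappa> A - nonlin_at \<kappa> B) \<le> (\<kappa> + 1 + 3 * r\<^sup>2) * norm (A - B)"
proof -
  let ?D = "A - B"
  have eq: "nonlin_at \<kappa> A - nonlin_at \<kappa> B = (\<kappa> + 1) *\<^sub>R ?D - (tri ?D A A + tri B ?D A + tri B B ?D)"
    by (simp add: nonlin_at_tri tri_linear algebra_simps)
  have "norm (nonlin_at \<kappa> A - nonlin_at \<kappa> B)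
      \<le> norm ((\<kappa> + 1) *\<^sub>R ?D) + (norm (tri ?D A A) + norm (tri B ?D A) + norm (tri B B ?D))"
    unfolding eq using norm_triangle_ineq4[of "(\<kappa> + 1) *\<^sub>R ?D" "tri ?D A A + tri B ?D A + tri B B ?D"]
      norm_triangle_ineq[of "tri ?D A A + tri B ?D A" "tri B B ?D"]
      norm_triangle_ineq[of "tri ?D A A" "tri B ?D A"] by linarith
  also have "\<dots> \<le> (\<kappa> + 1) * norm ?D
      + (norm ?D * r * r + r * norm ?D * r + r * r * norm ?D)"
    using assms by (intro add_mono norm_tri_le_bounds) auto
  also have "\<dots> = (\<kappa> + 1 + 3 * r\<^sup>2) * norm ?D"
    by (simp add: algebra_simps power2_eq_square)
  finally show ?thesis .
qed

text \<open>
  Along the segment from \<open>A\<close> to \<open>B\<close> the nonlinearity is a cubic polynomial in \<open>\<theta>\<close>. Its affine part is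
  reproduced by linear interpolation, and the quadratic and cubic coefficients are both of second
  order in \<open>B - A\<close>. This replaces a bound on the second derivative of the nonlinearity composed with
  the solution. The \<open>5\<close> is \<open>3\<close> for the three quadratic terms and \<open>2\<close> for the cubic one, in which one
  factor \<open>norm (B - A)\<close> is estimated by \<open>2 * r\<close>.
\<close>

lemma norm_nonlin_at_interpolation_le:
  fixes A B :: "real ^ 'n ^ 'n"
  assumes A: "norm A \<le> r" and B: "norm B \<le> r" and \<theta>: "0 \<le> \<theta>" "\<theta> \<le> 1"
  shows "norm ((1 - \<theta>) *\<^sub>R nonlin_at \<kappa> A + \<theta> *\<^sub>R nonlin_at \<kappa> B - nonlin_at \<kappa> ((1 - \<theta>) *\<^sub>R A + \<theta> *\<^sub>R B))
    \<le> 5 * r * (norm (B - A))\<^sup>2"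
proof -
  define D where "D = B - A"
  define L where "L = tri D A A + tri A D A + tri A A D"
  define Q where "Q = tri A D D + tri D A D + tri D D A"
  have D: "norm D \<le> 2 * r"
    unfolding D_def using norm_triangle_ineq4[of B A] A B by linarith
  have expand: "tri (A + c *\<^sub>R D) (A + c *\<^sub>R D) (A + c *\<^sub>R D)
      = tri A A A + c *\<^sub>R L + c\<^sup>2 *\<^sub>R Q + c ^ 3 *\<^sub>R tri D D D" for c
    unfolding L_def Q_def tri_linear scaleR_add_right scaleR_scaleR
    by (simp add: power2_eq_square power3_eq_cube mult.assoc)
  have B_eq: "B = A + 1 *\<^sub>R D" by (simp add: D_def)
  have lin: "(1 - \<theta>) *\<^sub>R A + \<theta> *\<^sub>R (A + 1 *\<^sub>R D) = A + \<theta> *\<^sub>R D"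
    by (simp add: algebra_simps)
  have "(1 - \<theta>) *\<^sub>R nonlin_at \<kappa> A + \<theta> *\<^sub>R nonlin_at \<kappa> B - nonlin_at \<kappa> ((1 - \<theta>) *\<^sub>R A + \<theta> *\<^sub>R B)
      = - ((\<theta> - \<theta>\<^sup>2) *\<^sub>R Q + (\<theta> - \<theta> ^ 3) *\<^sub>R tri D D D)"
    unfolding B_eq lin nonlin_at_tri expand by (simp add: algebra_simps)
  also have "norm \<dots> \<le> \<bar>\<theta> - \<theta>\<^sup>2\<bar> * norm Q + \<bar>\<theta> - \<theta> ^ 3\<bar> * norm (tri D D D)"
    unfolding norm_minus_cancel by (rule order_trans[OF norm_triangle_ineq]) simp
  also have "\<dots> \<le> 1 * (3 * r * (norm D)\<^sup>2) + 1 * (2 * r * (norm D)\<^sup>2)"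
  proof (intro add_mono mult_mono)
    have "0 \<le> \<theta> - \<theta>\<^sup>2" "0 \<le> \<theta> - \<theta> ^ 3" "0 \<le> \<theta>\<^sup>2" "0 \<le> \<theta> ^ 3"
      using \<theta> power_decreasing[of 1 2 \<theta>] power_decreasing[of 1 3 \<theta>] by auto
    with \<theta> show "\<bar>\<theta> - \<theta>\<^sup>2\<bar> \<le> 1" "\<bar>\<theta> - \<theta> ^ 3\<bar> \<le> 1"
      unfolding abs_le_iff by linarith+
    have "norm Q \<le> norm (tri A D D) + norm (tri D A D) + norm (tri D D A)"
      unfolding Q_def using norm_triangle_ineq[of "tri A D D + tri D A D" "tri D D A"]
        norm_triangle_ineq[of "tri A D D" "tri D A D"] by linarith
    also have "\<dots> \<le> r * norm D * norm D + norm D * r * norm D + norm D * norm D * r"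
      using A by (intro add_mono norm_tri_le_bounds) auto
    finally show "norm Q \<le> 3 * r * (norm D)\<^sup>2"
      by (simp add: algebra_simps power2_eq_square)
    have "norm (tri D D D) \<le> (2 * r) * norm D * norm D"
      using D by (intro norm_tri_le_bounds) auto
    then show "norm (tri D D D) \<le> 2 * r * (norm D)\<^sup>2"
      by (simp add: power2_eq_square)
  qed auto
  finally show ?thesis
    by (simp add: D_def)
qed

section \<open>Dissipativity of the periodic Laplacian\<close>

lemma second_derivative_nonpos_at_max:
  fixes f f' :: "real \<Rightarrow> real"
  assumes f: "\<And>h. (f has_real_derivative f' h) (at h)"
    and f': "(f' has_real_derivative l) (at 0)"
    and max: "\<And>h. f h \<le> f 0"
  shows "l \<le> 0"
proof (rule ccontr)
  assume "\<not> l \<le> 0"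
  then obtain d where d: "d > 0" and inc: "\<forall>h>0. h < d \<longrightarrow> f' 0 < f' (0 + h)"
    using DERIV_pos_inc_right[OF f'] by force
  have "f' 0 = 0"
    using DERIV_local_max[OF f[of 0], of 1] max by simp
  moreover have "\<exists>z. 0 < z \<and> z < d / 2 \<and> f (d / 2) - f 0 = (d / 2 - 0) * f' z"
    using d by (intro MVT2) (auto intro: f)
  then obtain z where z: "0 < z" "z < d / 2" "f (d / 2) - f 0 = d / 2 * f' z"
    by auto
  moreover have "f' 0 < f' z"
    using inc z d by auto
  ultimately have "0 < d / 2 * f' z"
    using d by (intro mult_pos_pos) auto
  with z(3) have "0 < f (d / 2) - f 0"
    by linarith
  with max[of "d / 2"] show False by simp
qed

lemma inner_has_real_derivative:
  fixes f g :: "real \<Rightarrow> 'a::real_inner"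
  assumes "(f has_vector_derivative f') (at x)" "(g has_vector_derivative g') (at x)"
  shows "((\<lambda>h. f h \<bullet> g h) has_real_derivative f x \<bullet> g' + f' \<bullet> g x) (at x)"
  unfolding has_real_derivative_iff_has_vector_derivative
  by (rule bounded_bilinear.has_vector_derivative[OF bounded_bilinear_inner assms])

lemma has_partial_along_line:
  assumes "has_partial i W V"
  shows "((\<lambda>h. at_point W (x + h *\<^sub>R axis i 1)) has_vector_derivative
    at_point V (x + h *\<^sub>R axis i 1)) (at h)"
proof -
  have "((\<lambda>k. at_point W ((x + h *\<^sub>R axis i 1) + k *\<^sub>R axis i 1)) has_vector_derivative
      at_point V (x + h *\<^sub>R axis i 1)) (at 0)"
    using assms unfolding has_partial_def by blast
  then have "(((\<lambda>k. at_point W ((x + h *\<^sub>R axis i 1) + k *\<^sub>R axis i 1)) \<circ> (\<lambda>k. k - h))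
      has_vector_derivative 1 *\<^sub>R at_point V (x + h *\<^sub>R axis i 1)) (at h)"
    by (intro vector_diff_chain_at) (auto intro!: derivative_eq_intros)
  then show ?thesis
    by (simp add: o_def algebra_simps)
qed

lemma norm_attained:
  fixes W :: "'n::finite per_field"
  obtains x where "norm W = norm (at_point W x)"
proof -
  have "compact (cell :: (real ^ 'n) set)" by (simp add: cell_def)
  then obtain x :: "real ^ 'n" where x: "\<forall>y\<in>cell. norm (at_point W y) \<le> norm (at_point W x)"
    using continuous_attains_sup[OF _ cell_nonempty, of "\<lambda>x. norm (at_point W x)"]
      continuous_at_point[of cell W] by (metis continuous_on_norm)
  have "norm W = norm (at_point W x)"
  proof (rule antisym[OF norm_per_field_le norm_at_point_le])
    show "norm (at_point W y) \<le> norm (at_point W x)" for y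
      by (metis cell_representative x)
  qed
  then show thesis by (rule that)
qed

text \<open>
  At a point \<open>x\<close> where the norm of \<open>W\<close> is attained, the squared norm along each coordinate line is
  maximal, so that its second derivative $2\langle W,\partial_i^2W\rangle+2|\partial_iW|^2$ is
  nonpositive. Thus $\langle W(x),V(x)\rangle\le0$, and pairing \<open>W - h *\<^sub>R V\<close> with \<open>W\<close> at \<open>x\<close> yields
  the estimate.
\<close>

lemma laplacian_dissipative:
  assumes "(W, V) \<in> laplacian" and h: "0 \<le> h"
  shows "norm W \<le> norm (W - h *\<^sub>R V)"
proof -
  obtain D D2 where D: "\<And>i. has_partial i W (D i)" "\<And>i j. has_partial j (D i) (D2 i j)"
    and V: "V = (\<Sum>i\<in>UNIV. D2 i i)"
    using assms(1) unfolding laplacian_def by blast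
  obtain x where x: "norm W = norm (at_point W x)"
    by (rule norm_attained)
  have "at_point W x \<bullet> at_point (D2 i i) x \<le> 0" for i
  proof -
    let ?y = "\<lambda>h. x + h *\<^sub>R axis i 1"
    have "2 * (at_point W x \<bullet> at_point (D2 i i) x + at_point (D i) x \<bullet> at_point (D i) x) \<le> 0"
    proof (rule second_derivative_nonpos_at_max)
      fix h
      show "((\<lambda>h. at_point W (?y h) \<bullet> at_point W (?y h)) has_real_derivative
          2 * (at_point W (?y h) \<bullet> at_point (D i) (?y h))) (at h)"
        using inner_has_real_derivative[OF has_partial_along_line[OF D(1)[of i], where x = x and h = h]
            has_partial_along_line[OF D(1)[of i], where x = x and h = h]]
        by (simp add: inner_commute)
      show "((\<lambda>h. 2 * (at_point W (?y h) \<bullet> at_point (D i) (?y h))) has_real_derivative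
          2 * (at_point W x \<bullet> at_point (D2 i i) x + at_point (D i) x \<bullet> at_point (D i) x)) (at 0)"
        using DERIV_cmult[OF inner_has_real_derivative[OF has_partial_along_line[OF D(1)[of i], where x = x and h = 0]
              has_partial_along_line[OF D(2)[of i i], where x = x and h = 0]], of 2]
        by simp
      show "at_point W (?y h) \<bullet> at_point W (?y h) \<le> at_point W (?y 0) \<bullet> at_point W (?y 0)"
        using norm_at_point_le[of W "?y h"] unfolding x by (simp add: norm_le)
    qed
    then have "at_point W x \<bullet> at_point (D2 i i) x \<le> - (at_point (D i) x \<bullet> at_point (D i) x)"
      by simp
    also have "\<dots> \<le> 0"
      by simp
    finally show ?thesis .
  qed
  moreover have "at_point V x = (\<Sum>i\<in>UNIV. at_point (D2 i i) x)"
    unfolding V by (induction rule: finite_induct[OF finite[of UNIV]]) auto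
  ultimately have "at_point W x \<bullet> at_point V x \<le> 0"
    by (simp add: inner_sum_right sum_nonpos)
  then have "(norm W)\<^sup>2 \<le> at_point W x \<bullet> at_point (W - h *\<^sub>R V) x"
    using h by (simp add: x power2_norm_eq_inner inner_diff_right mult_nonneg_nonpos)
  also have "\<dots> \<le> norm W * norm (W - h *\<^sub>R V)"
    unfolding x by (rule order_trans[OF norm_cauchy_schwarz]) (intro mult_left_mono norm_at_point_le norm_ge_zero)
  finally show ?thesis
    by (cases "norm W = 0") (auto simp: power2_eq_square)
qed

text \<open>
  The inequality is a closed condition on the pair, and therefore passes from the classical Laplacian
  to the closure of its graph.
\<close>

lemma generator_dissipative:
  assumes "heat_semigroup \<epsilon> S" and "(x, y) \<in> generator S" and h: "0 \<le> h"
  shows "norm x \<le> norm (x - h *\<^sub>R y)"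
proof -
  let ?G = "{(W, \<epsilon>\<^sup>2 *\<^sub>R V) | W V. (W, V) \<in> laplacian}"
  let ?H = "{p. norm (fst p) \<le> norm (fst p - h *\<^sub>R snd p)}"
  have "?G \<subseteq> ?H"
    using laplacian_dissipative[where h = "h * \<epsilon>\<^sup>2"] h by auto
  moreover have "closed ?H"
    by (intro closed_Collect_le continuous_intros)
  ultimately have "closure ?G \<subseteq> ?H"
    by (rule closure_minimal)
  then show ?thesis
    using assms unfolding heat_semigroup_def by auto
qed

section \<open>Strongly continuous semigroups with dissipative generator\<close>

lemma right_difference_quotient:
  fixes f :: "real \<Rightarrow> 'a::real_normed_vector"
  assumes f: "(f has_vector_derivative v) (at t within {a..b})" and t: "a \<le> t" "t < b"
  shows "((\<lambda>h. (1 / h) *\<^sub>R (f (t + h) - f t)) \<longlongrightarrow> v) (at_right 0)"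
proof -
  have "(f has_vector_derivative v) (at t within {t..b})"
    using t by (intro has_vector_derivative_within_subset[OF f]) auto
  then have "((\<lambda>s. (1 / norm (s - t)) *\<^sub>R (f s - (f t + (s - t) *\<^sub>R v))) \<longlongrightarrow> 0) (at_right t)"
    using t by (simp add: has_vector_derivative_def has_derivative_within at_within_Icc_at_right inverse_eq_divide)
  then have "((\<lambda>h. (1 / norm h) *\<^sub>R (f (t + h) - (f t + h *\<^sub>R v))) \<longlongrightarrow> 0) (at_right 0)"
    by (simp add: filterlim_at_right_to_0[of _ _ t] add.commute)
  moreover have "\<forall>\<^sub>F h in at_right 0. (1 / norm h) *\<^sub>R (f (t + h) - (f t + h *\<^sub>R v))
      = (1 / h) *\<^sub>R (f (t + h) - f t) - v"
    using eventually_at_right_less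
    by eventually_elim (simp add: algebra_simps)
  ultimately have "((\<lambda>h. (1 / h) *\<^sub>R (f (t + h) - f t) - v) \<longlongrightarrow> 0) (at_right 0)"
    by (rule Lim_transform_eventually)
  then show ?thesis by (simp add: LIM_zero_iff)
qed

locale strongly_continuous =
  fixes S :: "real \<Rightarrow> 'a::banach \<Rightarrow> 'a"
  assumes C0: "C0_semigroup S"
begin

lemma bounded_linear: "0 \<le> t \<Longrightarrow> bounded_linear (S t)"
  and at_0: "S 0 x = x"
  and semigroup: "0 \<le> s \<Longrightarrow> 0 \<le> t \<Longrightarrow> S (s + t) x = S s (S t x)"
  and tendsto_at_0: "((\<lambda>t. S t x) \<longlongrightarrow> x) (at_right 0)"
  using C0 unfolding C0_semigroup_def by auto

text \<open>
  Uniform boundedness. By strong continuity at \<open>0\<close> every \<open>x\<close> lies in one of the closed sets of points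
  whose orbit stays below \<open>n\<close> up to time \<open>1 / (n + 1)\<close>; by the theorem of Baire one of them contains a
  ball, and differences of elements of this ball bound the operators.
\<close>

lemma bounded_near_0:
  obtains \<delta> M where "\<delta> > 0" "\<And>t x. 0 \<le> t \<Longrightarrow> t \<le> \<delta> \<Longrightarrow> norm (S t x) \<le> M * norm x"
proof -
  define F where "F n = {x. \<forall>t\<in>{0..inverse (real (Suc n))}. norm (S t x) \<le> real n}" for n
  have closed_F: "closed (F n)" for n
  proof -
    have "F n = (\<Inter>t\<in>{0..inverse (real (Suc n))}. {x. norm (S t x) \<le> real n})"
      by (auto simp: F_def)
    moreover have "closed {x. norm (S t x) \<le> real n}" if "0 \<le> t" for t
      by (intro closed_Collect_le continuous_on_norm continuous_on_const
          linear_continuous_on bounded_linear that)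
    ultimately show ?thesis by auto
  qed
  have "\<exists>n. x \<in> F n" for x
  proof -
    have "\<forall>\<^sub>F t in at_right 0. norm (S t x - x) < 1"
      using tendsto_at_0[of x] unfolding tendsto_iff dist_norm by simp
    then obtain d where d: "d > 0" "\<And>t. 0 < t \<Longrightarrow> t < d \<Longrightarrow> norm (S t x - x) < 1"
      unfolding eventually_at_right_field by auto
    obtain n where n: "inverse (real (Suc n)) < d"
      using reals_Archimedean[OF d(1)] by auto
    obtain k where k: "norm x + 1 \<le> real k"
      using real_arch_simple by blast
    have "norm (S t x) \<le> real (n + k)" if "0 \<le> t" "t \<le> inverse (real (Suc (n + k)))" for t
    proof (cases "t = 0")
      case True
      then show ?thesis using k by (simp add: at_0)
    next
      case False
      have "inverse (real (Suc (n + k))) \<le> inverse (real (Suc n))"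
        by (intro le_imp_inverse_le) auto
      then have "t < d" using that(2) n by linarith
      with False that have "norm (S t x - x) < 1"
        by (intro d) auto
      then show ?thesis
        using k norm_triangle_sub[of "S t x" x] by simp
    qed
    then have "x \<in> F (n + k)" unfolding F_def by simp
    then show ?thesis ..
  qed
  then have "(\<Union>n. F n) = UNIV" by blast
  have "\<exists>n. interior (F n) \<noteq> {}"
  proof (rule ccontr)
    assume "\<not> ?thesis"
    then have "euclidean interior_of \<Union> (range F) = {}"
      using closed_F
      by (intro Baire_category_alt) (auto simp: completely_metrizable_space_euclidean)
    with \<open>(\<Union>n. F n) = UNIV\<close> show False by simp
  qed
  then obtain n x0 where "x0 \<in> interior (F n)"
    by blast
  then obtain r where r: "r > 0" "cball x0 r \<subseteq> F n"
    unfolding mem_interior_cball by blast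
  have "norm (S t x) \<le> (2 * real n / r) * norm x"
    if t: "0 \<le> t" "t \<le> inverse (real (Suc n))" for t x
  proof (cases "x = 0")
    case True
    then show ?thesis using linear_0[OF bounded_linear.linear[OF bounded_linear[OF t(1)]]] by simp
  next
    case False
    interpret bounded_linear "S t" by (rule bounded_linear[OF t(1)])
    let ?c = "r / norm x"
    \<comment> \<open>x is rescaled to length r, and its multiple is a difference of two points of the ball\<close>
    have "x0 + ?c *\<^sub>R x \<in> cball x0 r" "x0 \<in> cball x0 r"
      using r(1) False by (auto simp: dist_norm)
    moreover have "norm (S t y) \<le> real n" if "y \<in> cball x0 r" for y
    proof -
      have "y \<in> F n" using r(2) that by blast
      then show ?thesis using t by (simp add: F_def)
    qed
    ultimately have "norm (S t (x0 + ?c *\<^sub>R x)) \<le> real n" "norm (S t x0) \<le> real n"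
      by blast+
    then have "norm (S t (?c *\<^sub>R x)) \<le> 2 * real n"
      using norm_triangle_ineq4[of "S t (x0 + ?c *\<^sub>R x)" "S t x0"] by (simp add: add)
    then show ?thesis
      using r(1) False by (simp add: scale field_simps)
  qed
  moreover have "0 < inverse (real (Suc n))" by simp
  ultimately show thesis using that by blast
qed

lemma bounded_on_interval:
  obtains K where "K \<ge> 1" "\<And>t x. 0 \<le> t \<Longrightarrow> t \<le> b \<Longrightarrow> norm (S t x) \<le> K * norm x"
proof -
  obtain \<delta> M0 where \<delta>: "\<delta> > 0" and M0: "\<And>t x. 0 \<le> t \<Longrightarrow> t \<le> \<delta> \<Longrightarrow> norm (S t x) \<le> M0 * norm x"
    using bounded_near_0 by blast
  define M where "M = max M0 1"
  have M: "norm (S t x) \<le> M * norm x" if "0 \<le> t" "t \<le> \<delta>" for t x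
    by (rule order_trans[OF M0[OF that]]) (simp add: M_def mult_right_mono)
  have M1: "1 \<le> M" by (simp add: M_def)
  have pow: "norm (S t x) \<le> M ^ Suc n * norm x" if "0 \<le> t" "t \<le> real (Suc n) * \<delta>" for n t x
    using that
  proof (induction n arbitrary: t)
    case 0
    then show ?case using M by simp
  next
    case (Suc n)
    show ?case
    proof (cases "t \<le> \<delta>")
      case True
      have "M ^ 1 \<le> M ^ Suc (Suc n)" using M1 by (intro power_increasing) auto
      then have "M * norm x \<le> M ^ Suc (Suc n) * norm x"
        by (intro mult_right_mono) simp_all
      with M[OF Suc.prems(1) True, of x] show ?thesis
        by linarith
    next
      case False
      have "S t x = S \<delta> (S (t - \<delta>) x)"
        using semigroup[of \<delta> "t - \<delta>" x] \<delta> False by simp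
      also have "norm \<dots> \<le> M * norm (S (t - \<delta>) x)"
        using \<delta> by (intro M) auto
      also have "\<dots> \<le> M * (M ^ Suc n * norm x)"
        using M1 False Suc.prems by (intro mult_left_mono Suc.IH) (auto simp: algebra_simps)
      finally show ?thesis by (simp add: mult.assoc)
    qed
  qed
  obtain n where "b / \<delta> \<le> real n" using real_arch_simple by blast
  then have "b \<le> real (Suc n) * \<delta>" using \<delta> by (simp add: field_simps)
  then show thesis
    by (intro that[of "M ^ Suc n"] one_le_power[OF M1] pow) auto
qed

text \<open>
  Continuity from the left is where the local bound on the operators is needed: the increment over
  \<open>[s, t]\<close> is \<open>S s\<close> applied to an increment at \<open>0\<close>.
\<close>

lemma continuous_on_orbit: "continuous_on {0..} (\<lambda>t. S t x)"
  unfolding continuous_on_iff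
proof (intro ballI allI impI)
  fix t e :: real
  assume t: "t \<in> {0..}" and e: "0 < e"
  obtain K where K: "K \<ge> 1" "\<And>s x. 0 \<le> s \<Longrightarrow> s \<le> t + 1 \<Longrightarrow> norm (S s x) \<le> K * norm x"
    using bounded_on_interval by blast
  have "\<forall>\<^sub>F h in at_right 0. norm (S h x - x) < e / K"
    using tendsto_at_0[of x] e K(1) unfolding tendsto_iff dist_norm by simp
  then obtain d where d: "d > 0" "\<And>h. 0 < h \<Longrightarrow> h < d \<Longrightarrow> norm (S h x - x) < e / K"
    unfolding eventually_at_right_field by auto
  have step: "norm (S r x - S s x) < e" if "0 \<le> s" "s < r" "r < s + d" "s \<le> t + 1" for r s
  proof -
    interpret bounded_linear "S s" by (rule bounded_linear[OF that(1)])
    have "S r x - S s x = S s (S (r - s) x - x)"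
      using semigroup[of s "r - s" x] that by (simp add: diff)
    also have "norm \<dots> \<le> K * norm (S (r - s) x - x)"
      using that by (intro K) auto
    also have "\<dots> < K * (e / K)"
      using that K(1) by (intro mult_strict_left_mono d) auto
    finally show ?thesis using K(1) by simp
  qed
  show "\<exists>d>0. \<forall>s\<in>{0..}. dist s t < d \<longrightarrow> dist (S s x) (S t x) < e"
  proof (intro exI[of _ "min d 1"] conjI ballI impI)
    fix s :: real
    assume s: "s \<in> {0..}" "dist s t < min d 1"
    show "dist (S s x) (S t x) < e"
      using step[of s t] step[of t s] s t e
      by (cases s t rule: linorder_cases) (auto simp: dist_norm norm_minus_commute)
  qed (use d in auto)
qed

lemma continuous_on_convolution:
  assumes g: "continuous_on {0..t} g"
  shows "continuous_on {0..t} (\<lambda>s. S (t - s) (g s))"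
  unfolding continuous_on_def
proof
  fix r assume r: "r \<in> {0..t}"
  obtain K where K: "K \<ge> 1" "\<And>s x. 0 \<le> s \<Longrightarrow> s \<le> t \<Longrightarrow> norm (S s x) \<le> K * norm x"
    using bounded_on_interval by blast
  have "continuous_on {0..t} (\<lambda>s. S (t - s) (g r))"
    by (rule continuous_on_compose2[OF continuous_on_orbit]) (intro continuous_intros, auto)
  then have lim: "((\<lambda>s. S (t - s) (g r)) \<longlongrightarrow> S (t - r) (g r)) (at r within {0..t})"
    using r unfolding continuous_on_def by blast
  have "((\<lambda>s. K * norm (g s - g r)) \<longlongrightarrow> K * norm (g r - g r)) (at r within {0..t})"
    using g r unfolding continuous_on_def by (intro tendsto_intros) auto
  then have small: "((\<lambda>s. K * norm (g s - g r)) \<longlongrightarrow> 0) (at r within {0..t})"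
    by simp
  have "\<forall>\<^sub>F s in at r within {0..t}. norm (S (t - s) (g s) - S (t - s) (g r)) \<le> K * norm (g s - g r)"
    unfolding eventually_at_filter
  proof (intro always_eventually allI impI)
    fix s assume s: "s \<in> {0..t}"
    then interpret bounded_linear "S (t - s)" by (intro bounded_linear) auto
    show "norm (S (t - s) (g s) - S (t - s) (g r)) \<le> K * norm (g s - g r)"
      using K(2)[of "t - s" "g s - g r"] s by (simp add: diff)
  qed
  then have "((\<lambda>s. S (t - s) (g s) - S (t - s) (g r)) \<longlongrightarrow> 0) (at r within {0..t})"
    using small by (rule Lim_null_comparison)
  from tendsto_add[OF this lim] show "((\<lambda>s. S (t - s) (g s)) \<longlongrightarrow> S (t - r) (g r)) (at r within {0..t})"
    by simp
qed

lemma generator_invariant: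
  assumes "(x, y) \<in> generator S" and t: "0 \<le> t"
  shows "(S t x, S t y) \<in> generator S"
proof -
  interpret bounded_linear "S t" by (rule bounded_linear[OF t])
  have "((\<lambda>h. (1 / h) *\<^sub>R (S h x - x)) \<longlongrightarrow> y) (at_right 0)"
    using assms(1) by (simp add: generator_def)
  from tendsto[OF this] have "((\<lambda>h. S t ((1 / h) *\<^sub>R (S h x - x))) \<longlongrightarrow> S t y) (at_right 0)" .
  moreover have "\<forall>\<^sub>F h in at_right 0. S t ((1 / h) *\<^sub>R (S h x - x)) = (1 / h) *\<^sub>R (S h (S t x) - S t x)"
    using eventually_at_right_less
  proof eventually_elim
    case (elim h)
    have "S t (S h x) = S h (S t x)"
      using t elim semigroup[of t h x] semigroup[of h t x] by (simp add: algebra_simps)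
    then show ?case by (simp add: scale diff)
  qed
  ultimately show ?thesis
    unfolding generator_def by (auto intro: Lim_transform_eventually)
qed

text \<open>
  The means $\frac1t\int_0^tS_sx\,ds$ belong to the domain of the generator, because applying \<open>S h\<close>
  only shifts the interval of integration; they tend to \<open>x\<close> as \<open>t\<close> tends to \<open>0\<close>.
\<close>

lemma generator_domain_dense:
  "\<exists>X Y. (\<forall>n. (X n, Y n) \<in> generator S) \<and> (X :: nat \<Rightarrow> 'a) \<longlonglongrightarrow> x"
proof -
  define F where "F t = integral {0..t} (\<lambda>s. S s x)" for t
  have cont: "continuous_on {0..b} (\<lambda>s. S s x)" for b
    by (rule continuous_on_subset[OF continuous_on_orbit]) auto
  have int: "(\<lambda>s. S s x) integrable_on {a..b}" if "0 \<le> a" for a b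
    using that by (intro integrable_continuous_real continuous_on_subset[OF continuous_on_orbit]) auto
  have quot: "((\<lambda>h. (1 / h) *\<^sub>R (F (t + h) - F t)) \<longlongrightarrow> S t x) (at_right 0)" if "0 \<le> t" for t
    using integral_has_vector_derivative[OF cont, of t "t + 1"] that unfolding F_def
    by (intro right_difference_quotient) auto
  have gen: "((1 / t) *\<^sub>R F t, (1 / t) *\<^sub>R (S t x - x)) \<in> generator S" if t: "0 < t" for t
  proof -
    have "((\<lambda>h. (1 / t) *\<^sub>R ((1 / h) *\<^sub>R (F (t + h) - F t) - (1 / h) *\<^sub>R (F (0 + h) - F 0)))
        \<longlongrightarrow> (1 / t) *\<^sub>R (S t x - S 0 x)) (at_right 0)"
      using t by (intro tendsto_intros quot) auto
    moreover have "\<forall>\<^sub>F h in at_right 0.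
        (1 / t) *\<^sub>R ((1 / h) *\<^sub>R (F (t + h) - F t) - (1 / h) *\<^sub>R (F (0 + h) - F 0))
        = (1 / h) *\<^sub>R (S h ((1 / t) *\<^sub>R F t) - (1 / t) *\<^sub>R F t)"
      using eventually_at_right_less
    proof eventually_elim
      case (elim h)
      interpret bounded_linear "S h" using elim by (intro bounded_linear) auto
      have "S h (F t) = integral {0..t} (S h \<circ> (\<lambda>s. S s x))"
        unfolding F_def by (rule integral_linear[symmetric]) (auto intro: int bounded_linear_axioms)
      also have "\<dots> = integral {0..t} ((\<lambda>s. S s x) \<circ> ((+) h))"
        using elim by (intro integral_cong) (auto simp: semigroup)
      also have "\<dots> = integral {0 + h..t + h} (\<lambda>s. S s x)"
        by (rule integral_shift_Icc_real)
      also have "\<dots> = F (t + h) - F h"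
        unfolding F_def using elim t Henstock_Kurzweil_Integration.integral_combine[of 0 h "t + h" "\<lambda>s. S s x", OF _ _ int]
        by (simp add: algebra_simps)
      finally have Ft: "S h (F t) = F (t + h) - F h" .
      moreover have "F 0 = 0" by (simp add: F_def)
      ultimately show ?case unfolding scale Ft by (simp add: algebra_simps)
    qed
    ultimately show ?thesis
      unfolding generator_def using Lim_transform_eventually by (auto simp: at_0)
  qed
  let ?t = "\<lambda>n. inverse (real (Suc n))"
  have "filterlim ?t (at_right 0) sequentially"
    using LIMSEQ_inverse_real_of_nat by (auto simp: filterlim_at)
  from filterlim_compose[OF quot[of 0] this]
  have "(\<lambda>n. (1 / ?t n) *\<^sub>R F (?t n)) \<longlonglongrightarrow> x"
    by (simp add: F_def at_0)
  moreover have "((1 / ?t n) *\<^sub>R F (?t n), (1 / ?t n) *\<^sub>R (S (?t n) x - x)) \<in> generator S" for n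
    by (rule gen) simp
  ultimately show ?thesis
    by (intro exI[of _ "\<lambda>n. (1 / ?t n) *\<^sub>R F (?t n)"]
        exI[of _ "\<lambda>n. (1 / ?t n) *\<^sub>R (S (?t n) x - x)"]) simp
qed

text \<open>
  For \<open>x\<close> in the domain, with image \<open>y\<close>, the vector \<open>S (r + h) x - h *\<^sub>R S (r + h) y\<close> differs from
  \<open>S r x\<close> by $o(h)$, uniformly for \<open>r \<le> t\<close>: this is an implicit Euler step, and dissipativity bounds
  \<open>norm (S (r + h) x)\<close> by \<open>norm (S r x)\<close> up to $o(h)$. Chaining \<open>n\<close> such steps of length \<open>t / n\<close> leaves
  an error that vanishes as \<open>n\<close> grows. Density of the domain removes the restriction on \<open>x\<close>.
\<close>

lemma contraction:
  assumes diss: "\<And>x y h. (x, y) \<in> generator S \<Longrightarrow> 0 \<le> h \<Longrightarrow> norm x \<le> norm (x - h *\<^sub>R y)"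
    and t: "0 \<le> t"
  shows "norm (S t x) \<le> norm x"
proof -
  have dom: "norm (S t x) \<le> norm x" if xy: "(x, y) \<in> generator S" for x y
  proof -
    obtain K where K: "K \<ge> 1" "\<And>s x. 0 \<le> s \<Longrightarrow> s \<le> t \<Longrightarrow> norm (S s x) \<le> K * norm x"
      using bounded_on_interval by blast
    define \<omega> where "\<omega> h = norm ((1 / h) *\<^sub>R (S h x - x) - S h y)" for h
    have "((\<lambda>h. (1 / h) *\<^sub>R (S h x - x) - S h y) \<longlongrightarrow> y - y) (at_right 0)"
      using xy tendsto_at_0 by (intro tendsto_diff) (auto simp: generator_def)
    then have \<omega>: "(\<omega> \<longlongrightarrow> 0) (at_right 0)"
      unfolding \<omega>_def by (simp add: tendsto_norm_zero)
    have step: "norm (S (r + h) x) \<le> norm (S r x) + h * (K * \<omega> h)" if "0 \<le> r" "r \<le> t" "0 < h" for r h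
    proof -
      interpret bounded_linear "S r" by (rule bounded_linear[OF that(1)])
      have eq: "S (r + h) x - h *\<^sub>R S (r + h) y = S r x + h *\<^sub>R S r ((1 / h) *\<^sub>R (S h x - x) - S h y)"
        using that by (simp add: scale diff scaleR_diff_right semigroup)
      have "norm (S (r + h) x) \<le> norm (S (r + h) x - h *\<^sub>R S (r + h) y)"
        using that by (intro diss generator_invariant xy) auto
      also have "\<dots> \<le> norm (S r x) + norm (h *\<^sub>R S r ((1 / h) *\<^sub>R (S h x - x) - S h y))"
        unfolding eq by (rule norm_triangle_ineq)
      also have "norm (h *\<^sub>R S r ((1 / h) *\<^sub>R (S h x - x) - S h y)) \<le> h * (K * \<omega> h)"
        using that K(2)[of r "(1 / h) *\<^sub>R (S h x - x) - S h y"] by (simp add: \<omega>_def)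
      finally show ?thesis by simp
    qed
    show ?thesis
    proof (cases "t = 0")
      case False
      with t have t: "0 < t" by simp
      have chain: "norm (S (real k * h) x) \<le> norm x + real k * (h * (K * \<omega> h))"
        if "0 < h" "real k * h \<le> t" for k h
        using that(2)
      proof (induction k)
        case 0
        then show ?case by (simp add: at_0)
      next
        case (Suc k)
        then have le: "real k * h \<le> t" using that(1) by (simp add: algebra_simps)
        have "norm (S (real k * h + h) x) \<le> norm (S (real k * h) x) + h * (K * \<omega> h)"
          using le that(1) by (intro step) auto
        with Suc.IH[OF le] show ?case by (simp add: algebra_simps)
      qed
      have bound: "norm (S t x) \<le> norm x + t * (K * \<omega> (t * inverse (real (Suc n))))" for n
      proof -
        let ?h = "t * inverse (real (Suc n))"
        have h: "real (Suc n) * ?h = t" by simp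
        have "norm (S (real (Suc n) * ?h) x) \<le> norm x + real (Suc n) * (?h * (K * \<omega> ?h))"
          using t by (intro chain) (simp_all only: h, auto)
        also have "real (Suc n) * (?h * (K * \<omega> ?h)) = t * (K * \<omega> ?h)"
          by (subst mult.assoc[symmetric], subst h, rule refl)
        finally show ?thesis unfolding h .
      qed
      have "filterlim (\<lambda>n. t * inverse (real (Suc n))) (at_right 0) sequentially"
        using tendsto_mult_right_zero[OF LIMSEQ_inverse_real_of_nat, of t] t by (auto simp: filterlim_at)
      from filterlim_compose[OF \<omega> this]
      have "(\<lambda>n. norm x + t * (K * \<omega> (t * inverse (real (Suc n))))) \<longlonglongrightarrow> norm x + t * (K * 0)"
        by (intro tendsto_intros)
      then have "(\<lambda>n. norm x + t * (K * \<omega> (t * inverse (real (Suc n))))) \<longlonglongrightarrow> norm x"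
        by simp
      then show ?thesis
        by (rule LIMSEQ_le_const) (use bound in auto)
    qed (simp add: at_0)
  qed
  obtain X Y where XY: "\<And>n. (X n, Y n) \<in> generator S" and lim: "(X :: nat \<Rightarrow> 'a) \<longlonglongrightarrow> x"
    using generator_domain_dense by metis
  interpret bounded_linear "S t" by (rule bounded_linear[OF t])
  show ?thesis
    by (rule LIMSEQ_le[OF tendsto_norm[OF tendsto[OF lim]] tendsto_norm[OF lim]])
      (use dom[OF XY] in auto)
qed

end

section \<open>Duhamel integrals of the damped semigroup\<close>

definition duhamel :: "real \<Rightarrow> (real \<Rightarrow> 'a \<Rightarrow> 'a::banach) \<Rightarrow> real \<Rightarrow> (real \<Rightarrow> 'a) \<Rightarrow> 'a"
  where "duhamel \<kappa> S t g = integral {0..t} (\<lambda>s. damped \<kappa> S (t - s) (g s))"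

text \<open>
  The total masses on \<open>[0, t]\<close> of the weights $e^{-\kappa(t-s)}$ and $e^{-\kappa(t-s)}s/t$, which are the
  exponential integrator functions usually called $\varphi_1$ and $\varphi_2$ (taken at $-\kappa t$) times \<open>t\<close>.
\<close>

definition phi1 :: "real \<Rightarrow> real \<Rightarrow> real"
  where "phi1 \<kappa> t = (1 - exp (- \<kappa> * t)) / \<kappa>"

definition phi2 :: "real \<Rightarrow> real \<Rightarrow> real"
  where "phi2 \<kappa> t = (1 - phi1 \<kappa> t / t) / \<kappa>"

lemma has_integral_phi1:
  assumes "\<kappa> > 0" "t > 0"
  shows "((\<lambda>s. exp (- \<kappa> * (t - s))) has_integral phi1 \<kappa> t) {0..t}"
proof -
  have "((\<lambda>s. exp (- \<kappa> * (t - s))) has_integral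
      exp (- \<kappa> * (t - t)) / \<kappa> - exp (- \<kappa> * (t - 0)) / \<kappa>) {0..t}"
    using assms
    by (intro fundamental_theorem_of_calculus)
      (auto simp flip: has_real_derivative_iff_has_vector_derivative
        intro!: derivative_eq_intros)
  then show ?thesis
    by (simp add: phi1_def diff_divide_distrib)
qed

lemma has_integral_phi2:
  assumes "\<kappa> > 0" "t > 0"
  shows "((\<lambda>s. exp (- \<kappa> * (t - s)) * (s / t)) has_integral phi2 \<kappa> t) {0..t}"
proof -
  let ?F = "\<lambda>s. exp (- \<kappa> * (t - s)) * (s / (t * \<kappa>) - 1 / (t * \<kappa> * \<kappa>))"
  have "(?F has_real_derivative exp (- \<kappa> * (t - s)) * (s / t)) (at s within {0..t})" for s
  proof -
    have "(?F has_real_derivative exp (- \<kappa> * (t - s)) * \<kappa> * (s / (t * \<kappa>) - 1 / (t * \<kappa> * \<kappa>))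
        + exp (- \<kappa> * (t - s)) * (1 / (t * \<kappa>))) (at s within {0..t})"
      using assms by (auto intro!: derivative_eq_intros)
    moreover have "exp (- \<kappa> * (t - s)) * \<kappa> * (s / (t * \<kappa>) - 1 / (t * \<kappa> * \<kappa>))
        + exp (- \<kappa> * (t - s)) * (1 / (t * \<kappa>)) = exp (- \<kappa> * (t - s)) * (s / t)"
      using assms by (simp add: field_simps)
    ultimately show ?thesis by simp
  qed
  then have "((\<lambda>s. exp (- \<kappa> * (t - s)) * (s / t)) has_integral ?F t - ?F 0) {0..t}"
    using assms
    by (intro fundamental_theorem_of_calculus)
      (auto simp flip: has_real_derivative_iff_has_vector_derivative)
  moreover have "?F t - ?F 0 = phi2 \<kappa> t"
    using assms by (simp add: phi1_def phi2_def field_simps)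
  ultimately show ?thesis by simp
qed

lemma phi1_bounds:
  assumes "\<kappa> > 0" "t > 0"
  shows "0 \<le> phi1 \<kappa> t" "phi1 \<kappa> t \<le> t"
  using assms exp_ge_add_one_self[of "- \<kappa> * t"] by (auto simp: phi1_def field_simps)

lemma phi2_bounds:
  assumes "\<kappa> > 0" "t > 0"
  shows "0 \<le> phi2 \<kappa> t" "phi2 \<kappa> t \<le> t / 2"
proof -
  show "0 \<le> phi2 \<kappa> t"
    using has_integral_nonneg[OF has_integral_phi2[OF assms]] assms by simp
  have "((\<lambda>s. s / t) has_integral t\<^sup>2 / (2 * t) - 0\<^sup>2 / (2 * t)) {0..t}"
    using assms
    by (intro fundamental_theorem_of_calculus)
      (auto simp flip: has_real_derivative_iff_has_vector_derivative
        intro!: derivative_eq_intros simp: field_simps)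
  then have lin: "((\<lambda>s. s / t) has_integral t / 2) {0..t}"
    using assms by (simp add: power2_eq_square)
  show "phi2 \<kappa> t \<le> t / 2"
  proof (rule has_integral_le[OF has_integral_phi2[OF assms] lin])
    fix s assume s: "s \<in> {0..t}"
    then have "exp (- \<kappa> * (t - s)) \<le> 1" "0 \<le> s / t" using assms by auto
    then show "exp (- \<kappa> * (t - s)) * (s / t) \<le> s / t"
      by (rule mult_left_le_one_le[OF _ exp_ge_zero, rotated])
  qed
qed

locale contraction_semigroup = strongly_continuous S for S :: "real \<Rightarrow> 'a::banach \<Rightarrow> 'a" +
  fixes \<kappa> :: real
  assumes norm_le: "0 \<le> t \<Longrightarrow> norm (S t x) \<le> norm x"
    and \<kappa>_pos: "0 < \<kappa>"
begin

lemma bounded_linear_damped: "0 \<le> t \<Longrightarrow> bounded_linear (damped \<kappa> S t)"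
  unfolding damped_def using bounded_linear by (rule bounded_linear_const_scaleR)

lemma norm_damped_le: "0 \<le> t \<Longrightarrow> norm (damped \<kappa> S t x) \<le> exp (- \<kappa> * t) * norm x"
  unfolding damped_def by (simp add: norm_le mult_left_mono)

lemma damped_semigroup:
  assumes "0 \<le> s" "0 \<le> t"
  shows "damped \<kappa> S (s + t) x = damped \<kappa> S s (damped \<kappa> S t x)"
proof -
  interpret bounded_linear "S s" by (rule bounded_linear[OF assms(1)])
  show ?thesis
    using assms by (simp add: damped_def semigroup scale exp_add[symmetric] algebra_simps)
qed

lemma continuous_on_damped_convolution:
  assumes "continuous_on {0..t} g"
  shows "continuous_on {0..t} (\<lambda>s. damped \<kappa> S (t - s) (g s))"
  unfolding damped_def
  by (intro continuous_on_scaleR continuous_on_convolution assms) (intro continuous_intros)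

lemma norm_duhamel_le:
  assumes t: "0 < t" and g: "continuous_on {0..t} g"
    and le: "\<And>s. 0 \<le> s \<Longrightarrow> s \<le> t \<Longrightarrow> norm (g s) \<le> \<alpha> + \<beta> * (s / t)"
  shows "norm (duhamel \<kappa> S t g) \<le> \<alpha> * phi1 \<kappa> t + \<beta> * phi2 \<kappa> t"
proof -
  have int: "((\<lambda>s. \<alpha> * exp (- \<kappa> * (t - s)) + \<beta> * (exp (- \<kappa> * (t - s)) * (s / t))) has_integral
      \<alpha> * phi1 \<kappa> t + \<beta> * phi2 \<kappa> t) {0..t}"
    by (intro has_integral_add has_integral_mult_right has_integral_phi1 has_integral_phi2 \<kappa>_pos t)
  have "norm (duhamel \<kappa> S t g) \<le>
      integral {0..t} (\<lambda>s. \<alpha> * exp (- \<kappa> * (t - s)) + \<beta> * (exp (- \<kappa> * (t - s)) * (s / t)))"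
    unfolding duhamel_def
  proof (rule integral_norm_bound_integral)
    show "(\<lambda>s. damped \<kappa> S (t - s) (g s)) integrable_on {0..t}"
      by (intro integrable_continuous_real continuous_on_damped_convolution g)
    show "(\<lambda>s. \<alpha> * exp (- \<kappa> * (t - s)) + \<beta> * (exp (- \<kappa> * (t - s)) * (s / t))) integrable_on {0..t}"
      using int by (rule has_integral_integrable)
    fix s assume s: "s \<in> {0..t}"
    then have "norm (damped \<kappa> S (t - s) (g s)) \<le> exp (- \<kappa> * (t - s)) * norm (g s)"
      by (intro norm_damped_le) auto
    also have "\<dots> \<le> exp (- \<kappa> * (t - s)) * (\<alpha> + \<beta> * (s / t))"
      using s by (intro mult_left_mono le) auto
    finally show "norm (damped \<kappa> S (t - s) (g s))
        \<le> \<alpha> * exp (- \<kappa> * (t - s)) + \<beta> * (exp (- \<kappa> * (t - s)) * (s / t))"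
      by (simp add: algebra_simps)
  qed
  then show ?thesis
    using integral_unique[OF int] by simp
qed

lemma duhamel_diff:
  assumes "continuous_on {0..t} f" "continuous_on {0..t} g"
  shows "duhamel \<kappa> S t f - duhamel \<kappa> S t g = duhamel \<kappa> S t (\<lambda>s. f s - g s)"
proof -
  have "duhamel \<kappa> S t f - duhamel \<kappa> S t g =
      integral {0..t} (\<lambda>s. damped \<kappa> S (t - s) (f s) - damped \<kappa> S (t - s) (g s))"
    unfolding duhamel_def
    by (intro integral_diff[symmetric] integrable_continuous_real
        continuous_on_damped_convolution assms)
  also have "\<dots> = duhamel \<kappa> S t (\<lambda>s. f s - g s)"
    unfolding duhamel_def
    by (intro integral_cong)
      (simp add: linear_diff[OF bounded_linear.linear[OF bounded_linear_damped]])
  finally show ?thesis .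
qed

text \<open>
  Split the integral at \<open>r\<close>: on the first part the semigroup law extracts \<open>damped \<kappa> S t\<close>, the second
  part is shifted to start at \<open>0\<close>.
\<close>

lemma duhamel_restart:
  assumes t: "0 \<le> t" and r: "0 \<le> r" and g: "continuous_on {0..r + t} g"
  shows "duhamel \<kappa> S (r + t) g =
    damped \<kappa> S t (duhamel \<kappa> S r g) + duhamel \<kappa> S t (\<lambda>s. g (r + s))"
proof -
  let ?f = "\<lambda>s. damped \<kappa> S (r + t - s) (g s)"
  have "integral {0..r + t} ?f = integral {0..r} ?f + integral {r..r + t} ?f"
    using t r
    by (intro Henstock_Kurzweil_Integration.integral_combine[symmetric] integrable_continuous_real
        continuous_on_damped_convolution g) auto
  also have "integral {0..r} ?f = integral {0..r} (damped \<kappa> S t \<circ> (\<lambda>s. damped \<kappa> S (r - s) (g s)))"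
    using t by (intro integral_cong) (simp add: damped_semigroup[symmetric] algebra_simps)
  also have "\<dots> = damped \<kappa> S t (duhamel \<kappa> S r g)"
    unfolding duhamel_def using t r
    by (intro integral_linear bounded_linear_damped integrable_continuous_real
        continuous_on_damped_convolution continuous_on_subset[OF g]) auto
  also have "integral {r..r + t} ?f = integral {0..t} (?f \<circ> ((+) r))"
    using integral_shift_Icc_real[of 0 t ?f r] by (simp add: add.commute)
  also have "\<dots> = duhamel \<kappa> S t (\<lambda>s. g (r + s))"
    unfolding duhamel_def by (intro integral_cong) simp
  finally show ?thesis
    unfolding duhamel_def .
qed

end

section \<open>The nonlinearity on periodic fields\<close>

lemma norm_nonlin_le:
  fixes W :: "'n::finite per_field"
  assumes "norm W \<le> sqrt (real CARD('n))" "2 \<le> \<kappa>" "real CARD('n) \<le> 2 * \<kappa>"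
  shows "norm (nonlin \<kappa> W) \<le> \<kappa> * sqrt (real CARD('n))"
  using assms
  by (intro norm_per_field_le) (simp add: at_point_nonlin norm_nonlin_at_le order_trans[OF norm_at_point_le])

lemma norm_nonlin_diff_le:
  fixes V W :: "'n::finite per_field"
  assumes "norm V \<le> r" "norm W \<le> r" and \<kappa>: "0 \<le> \<kappa>"
  shows "norm (nonlin \<kappa> V - nonlin \<kappa> W) \<le> (\<kappa> + 1 + 3 * r\<^sup>2) * norm (V - W)"
proof (rule norm_per_field_le)
  fix x
  have "norm (at_point (nonlin \<kappa> V - nonlin \<kappa> W) x)
      \<le> (\<kappa> + 1 + 3 * r\<^sup>2) * norm (at_point V x - at_point W x)"
    using assms norm_at_point_le[of V x] norm_at_point_le[of W x]
    by (simp add: at_point_nonlin norm_nonlin_at_diff_le)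
  also have "\<dots> \<le> (\<kappa> + 1 + 3 * r\<^sup>2) * norm (V - W)"
    using \<kappa> norm_at_point_le[of "V - W" x] by (intro mult_left_mono) auto
  finally show "norm (at_point (nonlin \<kappa> V - nonlin \<kappa> W) x) \<le> (\<kappa> + 1 + 3 * r\<^sup>2) * norm (V - W)" .
qed

lemma norm_nonlin_interpolation_le:
  fixes V W :: "'n::finite per_field"
  assumes V: "norm V \<le> r" and W: "norm W \<le> r" and \<theta>: "0 \<le> \<theta>" "\<theta> \<le> 1"
  shows "norm ((1 - \<theta>) *\<^sub>R nonlin \<kappa> V + \<theta> *\<^sub>R nonlin \<kappa> W - nonlin \<kappa> ((1 - \<theta>) *\<^sub>R V + \<theta> *\<^sub>R W))
    \<le> 5 * r * (norm (W - V))\<^sup>2"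
proof (rule norm_per_field_le)
  fix x
  have r: "0 \<le> r" using V norm_ge_zero order_trans by blast
  have "norm ((1 - \<theta>) *\<^sub>R nonlin_at \<kappa> (at_point V x) + \<theta> *\<^sub>R nonlin_at \<kappa> (at_point W x)
      - nonlin_at \<kappa> ((1 - \<theta>) *\<^sub>R at_point V x + \<theta> *\<^sub>R at_point W x))
    \<le> 5 * r * (norm (at_point W x - at_point V x))\<^sup>2"
    using V W \<theta> norm_at_point_le[of V x] norm_at_point_le[of W x]
    by (intro norm_nonlin_at_interpolation_le) auto
  also have "\<dots> \<le> 5 * r * (norm (W - V))\<^sup>2"
    using r norm_at_point_le[of "W - V" x] by (intro mult_left_mono power_mono) auto
  finally show "norm (at_point ((1 - \<theta>) *\<^sub>R nonlin \<kappa> V + \<theta> *\<^sub>R nonlin \<kappa> W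
      - nonlin \<kappa> ((1 - \<theta>) *\<^sub>R V + \<theta> *\<^sub>R W)) x) \<le> 5 * r * (norm (W - V))\<^sup>2"
    by (simp add: at_point_nonlin)
qed

lemma continuous_on_nonlin:
  fixes u :: "real \<Rightarrow> 'n::finite per_field"
  assumes u: "continuous_on A u" and r: "\<And>s. s \<in> A \<Longrightarrow> norm (u s) \<le> r" and \<kappa>: "0 \<le> \<kappa>"
  shows "continuous_on A (\<lambda>s. nonlin \<kappa> (u s))"
proof -
  have "(\<kappa> + 1 + 3 * r\<^sup>2)-lipschitz_on (cball 0 r) (nonlin \<kappa> :: 'n per_field \<Rightarrow> _)"
    using \<kappa> by (intro lipschitz_onI) (auto simp: dist_norm norm_nonlin_diff_le)
  then have "continuous_on (cball 0 r) (nonlin \<kappa> :: 'n per_field \<Rightarrow> _)"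
    by (rule lipschitz_on_continuous_on)
  then show ?thesis
    using u by (rule continuous_on_compose2) (use r in auto)
qed

section \<open>Regularity in time\<close>

lemma vector_derivative_bound:
  fixes f :: "real \<Rightarrow> 'a::real_normed_vector"
  assumes f: "\<And>t. t \<in> {a..b} \<Longrightarrow> (f has_vector_derivative f' t) (at t within {a..b})"
    and B: "\<And>t. t \<in> {a..b} \<Longrightarrow> norm (f' t) \<le> B" and st: "s \<in> {a..b}" "t \<in> {a..b}"
  shows "norm (f s - f t) \<le> B * \<bar>s - t\<bar>"
proof -
  have "norm (f s - f t) \<le> B * norm (s - t)"
  proof (rule differentiable_bound[of "{a..b}" f "\<lambda>t h. h *\<^sub>R f' t"])
    fix t assume t: "t \<in> {a..b}"
    show "(f has_derivative (\<lambda>h. h *\<^sub>R f' t)) (at t within {a..b})"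
      using f[OF t] by (simp add: has_vector_derivative_def)
    show "onorm (\<lambda>h. h *\<^sub>R f' t) \<le> B"
      using B[OF t] by (intro onorm_le) (simp add: mult.commute[of B] mult_left_mono)
  qed (use st in auto)
  then show ?thesis by simp
qed

lemma C2_in_time_bounds:
  fixes U :: "real \<Rightarrow> 'a::real_normed_vector"
  assumes U: "C2_in_time T U" and T: "0 < T"
  obtains U' where "\<And>t. t \<in> {0..T} \<Longrightarrow> (U has_vector_derivative U' t) (at t within {0..T})"
    and "\<And>t. t \<in> {0..T} \<Longrightarrow> norm (U' t) \<le> C2_norm T U"
    and "\<And>s t. s \<in> {0..T} \<Longrightarrow> t \<in> {0..T} \<Longrightarrow> norm (U' s - U' t) \<le> C2_norm T U * \<bar>s - t\<bar>"
proof -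
  let ?D = "\<lambda>k. (time_deriv T ^^ k) U"
  have deriv: "(?D k has_vector_derivative ?D (Suc k) t) (at t within {0..T})"
    if "k < 2" "t \<in> {0..T}" for k t
  proof -
    have "?D k differentiable (at t within {0..T})"
      using U that unfolding C2_in_time_def by blast
    then have "(?D k has_vector_derivative time_deriv T (?D k) t) (at t within {0..T})"
      unfolding time_deriv_def by (rule vector_derivative_works[THEN iffD1])
    then show ?thesis by simp
  qed
  have cont: "continuous_on {0..T} (?D k)" if "k \<le> 2" for k
  proof (cases "k < 2")
    case True
    then show ?thesis
      using U unfolding C2_in_time_def
      by (intro differentiable_imp_continuous_on) (simp add: differentiable_on_def)
  next
    case False
    with that have "k = 2" by simp
    then show ?thesis using U unfolding C2_in_time_def by blast
  qed
  have bdd: "bdd_above ((\<lambda>t. norm (?D k t)) ` {0..T})" if "k \<le> 2" for k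
    using cont[OF that]
    by (intro bounded_imp_bdd_above compact_imp_bounded compact_continuous_image
        continuous_on_norm) auto
  have nonneg: "0 \<le> (SUP t\<in>{0..T}. norm (?D k t))" if "k \<le> 2" for k
    using T by (intro cSUP_upper2[OF bdd[OF that], of 0]) auto
  have le: "norm (?D k t) \<le> C2_norm T U" if k: "k \<le> 2" and t: "t \<in> {0..T}" for k t
  proof -
    have "norm (?D k t) \<le> (SUP t\<in>{0..T}. norm (?D k t))"
      using bdd[OF k] t by (intro cSUP_upper)
    also have "\<dots> \<le> C2_norm T U"
      unfolding C2_norm_def
      using member_le_sum[of k "{..2}" "\<lambda>k. SUP t\<in>{0..T}. norm (?D k t)"] k nonneg by auto
    finally show ?thesis .
  qed
  show thesis
  proof (rule that[of "?D 1"])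
    show "(U has_vector_derivative ?D 1 t) (at t within {0..T})" if "t \<in> {0..T}" for t
      using deriv[of 0 t] that by simp
    show "norm (?D 1 t) \<le> C2_norm T U" if "t \<in> {0..T}" for t
      using le[of 1 t] that by simp
    show "norm (?D 1 s - ?D 1 t) \<le> C2_norm T U * \<bar>s - t\<bar>"
      if "s \<in> {0..T}" "t \<in> {0..T}" for s t
      using that le[of 2] deriv[of 1]
      by (intro vector_derivative_bound[where f' = "?D 2"]) (auto simp: numeral_2_eq_2)
  qed
qed

text \<open>
  Both \<open>u (t + s)\<close> and \<open>u (t + \<tau>)\<close> are expanded to first order at \<open>t\<close>. The two terms with slope
  \<open>u' t\<close> cancel in the interpolation error, and each remainder is at most \<open>M * \<tau>\<^sup>2\<close> because \<open>u'\<close> is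
  Lipschitz with constant \<open>M\<close>.
\<close>

lemma linear_interpolation_error:
  fixes u :: "real \<Rightarrow> 'a::real_normed_vector"
  assumes u: "\<And>t. t \<in> {a..b} \<Longrightarrow> (u has_vector_derivative u' t) (at t within {a..b})"
    and u': "\<And>s t. s \<in> {a..b} \<Longrightarrow> t \<in> {a..b} \<Longrightarrow> norm (u' s - u' t) \<le> M * \<bar>s - t\<bar>"
    and s: "0 \<le> s" "s \<le> \<tau>" and \<tau>: "0 < \<tau>" "a \<le> t" "t + \<tau> \<le> b" and M: "0 \<le> M"
  shows "norm (u (t + s) - ((1 - s / \<tau>) *\<^sub>R u t + (s / \<tau>) *\<^sub>R u (t + \<tau>))) \<le> 2 * M * \<tau>\<^sup>2"
proof -
  have taylor: "norm (u (t + h) - u t - h *\<^sub>R u' t) \<le> M * \<tau>\<^sup>2" if h: "0 \<le> h" "h \<le> \<tau>" for h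
  proof -
    have "norm ((u (t + h) - (t + h) *\<^sub>R u' t) - (u t - t *\<^sub>R u' t)) \<le> M * \<tau> * \<bar>(t + h) - t\<bar>"
    proof (rule vector_derivative_bound[where f' = "\<lambda>r. u' r - u' t" and a = t and b = "t + \<tau>"])
      fix r assume r: "r \<in> {t..t + \<tau>}"
      have "(u has_vector_derivative u' r) (at r within {t..t + \<tau>})"
        using r \<tau> by (intro has_vector_derivative_within_subset[OF u]) auto
      then show "((\<lambda>r. u r - r *\<^sub>R u' t) has_vector_derivative u' r - u' t) (at r within {t..t + \<tau>})"
        by (auto intro!: derivative_eq_intros)
      have "norm (u' r - u' t) \<le> M * \<bar>r - t\<bar>"
        using r \<tau> by (intro u') auto
      also have "\<dots> \<le> M * \<tau>"
        using r M by (intro mult_left_mono) auto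
      finally show "norm (u' r - u' t) \<le> M * \<tau>" .
    qed (use h in auto)
    also have "\<dots> \<le> M * \<tau> * \<tau>"
      using h M \<tau> by (intro mult_left_mono) auto
    finally show ?thesis by (simp add: algebra_simps power2_eq_square)
  qed
  let ?R = "\<lambda>h. u (t + h) - u t - h *\<^sub>R u' t"
  have "u (t + s) - ((1 - s / \<tau>) *\<^sub>R u t + (s / \<tau>) *\<^sub>R u (t + \<tau>)) = ?R s - (s / \<tau>) *\<^sub>R ?R \<tau>"
    using \<tau> by (simp add: algebra_simps)
  also have "norm \<dots> \<le> norm (?R s) + (s / \<tau>) * norm (?R \<tau>)"
    using norm_triangle_ineq4[of "?R s" "(s / \<tau>) *\<^sub>R ?R \<tau>"] s \<tau> by simp
  also have "\<dots> \<le> M * \<tau>\<^sup>2 + 1 * (M * \<tau>\<^sup>2)"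
    using s \<tau> M by (intro add_mono mult_mono taylor) auto
  finally show ?thesis by simp
qed

section \<open>Local and global error of the scheme\<close>

lemma etd_predictor_duhamel:
  "etd_predictor \<kappa> S \<tau> V = damped \<kappa> S \<tau> V + duhamel \<kappa> S \<tau> (\<lambda>s. nonlin \<kappa> V)"
  by (simp add: etd_predictor_def duhamel_def)

lemma etdrk2_step_duhamel:
  "etdrk2_step \<kappa> S \<tau> V = damped \<kappa> S \<tau> V + duhamel \<kappa> S \<tau>
    (\<lambda>s. (1 - s / \<tau>) *\<^sub>R nonlin \<kappa> V + (s / \<tau>) *\<^sub>R nonlin \<kappa> (etd_predictor \<kappa> S \<tau> V))"
  by (simp add: etdrk2_step_def duhamel_def)

locale etdrk2_setting = contraction_semigroup S \<kappa>
  for S :: "real \<Rightarrow> 'n::finite per_field \<Rightarrow> 'n per_field" and \<kappa> :: real +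
  fixes m \<tau> :: real
  assumes m_def: "m = real CARD('n)"
    and \<kappa>_ge: "2 \<le> \<kappa>" "m \<le> 2 * \<kappa>"
    and \<tau>_pos: "0 < \<tau>"
begin

text \<open>
  \<open>L\<close> is the Lipschitz constant of the nonlinearity on the ball of radius \<open>sqrt m\<close>. Only \<open>a = L - \<kappa>\<close>,
  what remains of it after compensation by the damping, governs the growth of errors.
\<close>

definition L :: real where "L = \<kappa> + 1 + 3 * m"
definition a :: real where "a = 1 + 3 * m"

lemma m_nonneg: "0 \<le> m"
  by (simp add: m_def)

lemma exp_phi1: "exp (- \<kappa> * \<tau>) = 1 - \<kappa> * phi1 \<kappa> \<tau>"
  using \<kappa>_ge by (simp add: phi1_def)

lemma kappa_phi2: "\<kappa> * phi2 \<kappa> \<tau> = 1 - phi1 \<kappa> \<tau> / \<tau>"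
  using \<kappa>_ge by (simp add: phi2_def)

lemma nonlin_bound: "norm (V :: 'n per_field) \<le> sqrt m \<Longrightarrow> norm (nonlin \<kappa> V) \<le> \<kappa> * sqrt m"
  using \<kappa>_ge unfolding m_def by (intro norm_nonlin_le) auto

lemma nonlin_lipschitz:
  "norm (V :: 'n per_field) \<le> sqrt m \<Longrightarrow> norm W \<le> sqrt m \<Longrightarrow>
    norm (nonlin \<kappa> V - nonlin \<kappa> W) \<le> L * norm (V - W)"
  using norm_nonlin_diff_le[of V "sqrt m" W \<kappa>] \<kappa>_ge m_nonneg by (simp add: L_def)

text \<open>
  The maximum bound principle: since $e^{-\kappa\tau}=1-\kappa\varphi$ for $\varphi=$ \<open>phi1 \<kappa> \<tau>\<close>, the
  contribution $\varphi\,\kappa\sqrt m$ of the source refills exactly what the damping removes from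
  $\sqrt m$.
\<close>

lemma norm_step_le:
  assumes V: "norm V \<le> sqrt m" and g: "continuous_on {0..\<tau>} g"
    and le: "\<And>s. 0 \<le> s \<Longrightarrow> s \<le> \<tau> \<Longrightarrow> norm (g s) \<le> \<kappa> * sqrt m"
  shows "norm (damped \<kappa> S \<tau> V + duhamel \<kappa> S \<tau> g) \<le> sqrt m"
proof -
  have "norm (damped \<kappa> S \<tau> V) \<le> (1 - \<kappa> * phi1 \<kappa> \<tau>) * norm V"
    using norm_damped_le[of \<tau> V] \<tau>_pos unfolding exp_phi1 by simp
  also have "\<dots> \<le> (1 - \<kappa> * phi1 \<kappa> \<tau>) * sqrt m"
    using V by (intro mult_left_mono) (simp_all flip: exp_phi1)
  finally have "norm (damped \<kappa> S \<tau> V) \<le> (1 - \<kappa> * phi1 \<kappa> \<tau>) * sqrt m" .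
  moreover have "norm (duhamel \<kappa> S \<tau> g) \<le> \<kappa> * sqrt m * phi1 \<kappa> \<tau> + 0 * phi2 \<kappa> \<tau>"
    using le \<tau>_pos by (intro norm_duhamel_le g) auto
  ultimately show ?thesis
    using norm_triangle_ineq[of "damped \<kappa> S \<tau> V" "duhamel \<kappa> S \<tau> g"]
    by (simp add: algebra_simps)
qed

lemma predictor_bound: "norm V \<le> sqrt m \<Longrightarrow> norm (etd_predictor \<kappa> S \<tau> V) \<le> sqrt m"
  unfolding etd_predictor_duhamel
  by (intro norm_step_le continuous_on_const nonlin_bound)

lemma step_bound:
  assumes V: "norm V \<le> sqrt m"
  shows "norm (etdrk2_step \<kappa> S \<tau> V) \<le> sqrt m"
  unfolding etdrk2_step_duhamel
proof (intro norm_step_le V)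
  let ?P = "etd_predictor \<kappa> S \<tau> V"
  let ?g = "\<lambda>s. (1 - s / \<tau>) *\<^sub>R nonlin \<kappa> V + (s / \<tau>) *\<^sub>R nonlin \<kappa> ?P"
  show "continuous_on {0..\<tau>} ?g"
    using \<tau>_pos by (intro continuous_intros) auto
  fix s assume s: "0 \<le> s" "s \<le> \<tau>"
  then have \<theta>: "0 \<le> s / \<tau>" "0 \<le> 1 - s / \<tau>" using \<tau>_pos by auto
  have "norm (?g s) \<le> (1 - s / \<tau>) * norm (nonlin \<kappa> V) + (s / \<tau>) * norm (nonlin \<kappa> ?P)"
    using \<theta> s \<tau>_pos by (intro order_trans[OF norm_triangle_ineq]) simp
  also have "\<dots> \<le> (1 - s / \<tau>) * (\<kappa> * sqrt m) + (s / \<tau>) * (\<kappa> * sqrt m)"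
    using \<theta> V by (intro add_mono mult_left_mono nonlin_bound predictor_bound)
  also have "\<dots> = \<kappa> * sqrt m"
    by (simp add: algebra_simps)
  finally show "norm (?g s) \<le> \<kappa> * sqrt m" .
qed

text \<open>
  Let $\varphi$, $\psi$ be the values of \<open>phi1\<close>, \<open>phi2\<close> at $\tau$ and \<open>e\<close> the initial error. As
  $e^{-\kappa\tau}=1-\kappa\varphi$ and $L=\kappa+a$, the predictor multiplies \<open>e\<close> by at most $1+a\varphi$.
  The corrector puts the weight $\psi$ on the predictor, and multiplies \<open>e\<close> by at most
  $1+a\varphi+L\psi a\varphi$. Since $\kappa\psi=1-\varphi/\tau$, this equals
  $1+a\varphi(2-\varphi/\tau)+a^2\varphi\psi$, in which \<open>\<kappa>\<close> occurs only through $\varphi$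
  and $\psi$, bounded by $\tau$ and $\tau/2$. The remaining terms come from the curvature of the solution and from the predictor:
  they are of order $\tau^2$ before the integration over the step.
\<close>

lemma one_step_error:
  assumes V: "norm V \<le> sqrt m"
    and u: "continuous_on {0..\<tau>} u" "\<And>s. 0 \<le> s \<Longrightarrow> s \<le> \<tau> \<Longrightarrow> norm (u s) \<le> sqrt m"
    and mild: "u \<tau> = damped \<kappa> S \<tau> (u 0) + duhamel \<kappa> S \<tau> (\<lambda>s. nonlin \<kappa> (u s))"
    and M: "0 \<le> M"
    and lip: "\<And>s. 0 \<le> s \<Longrightarrow> s \<le> \<tau> \<Longrightarrow> norm (u s - u 0) \<le> M * s"
    and interp: "\<And>s. 0 \<le> s \<Longrightarrow> s \<le> \<tau> \<Longrightarrow>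
      norm (u s - ((1 - s / \<tau>) *\<^sub>R u 0 + (s / \<tau>) *\<^sub>R u \<tau>)) \<le> 2 * M * \<tau>\<^sup>2"
  shows "norm (etdrk2_step \<kappa> S \<tau> V - u \<tau>) \<le> (1 + a * \<tau> + (a * \<tau>)\<^sup>2 / 2) * norm (V - u 0)
    + (L\<^sup>2 * M / 4 + 2 * L * M + 5 * sqrt m * M\<^sup>2) * \<tau> ^ 3"
proof -
  define e where "e = norm (V - u 0)"
  define \<phi> where "\<phi> = phi1 \<kappa> \<tau>"
  define \<psi> where "\<psi> = phi2 \<kappa> \<tau>"
  define G where "G = 2 * L * M + 5 * sqrt m * M\<^sup>2"
  let ?P = "etd_predictor \<kappa> S \<tau> V"
  let ?N = "\<lambda>s. nonlin \<kappa> (u s)"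
  have u0: "norm (u 0) \<le> sqrt m" and u\<tau>: "norm (u \<tau>) \<le> sqrt m"
    using u(2) \<tau>_pos by auto
  have L: "0 \<le> L" and a: "0 \<le> a" and La: "L = \<kappa> + a" and e: "0 \<le> e"
    using \<kappa>_ge m_nonneg by (auto simp: L_def a_def e_def)
  have \<phi>: "0 \<le> \<phi>" "\<phi> \<le> \<tau>" and \<psi>: "0 \<le> \<psi>" "\<psi> \<le> \<tau> / 2"
    using phi1_bounds phi2_bounds \<kappa>_pos \<tau>_pos by (auto simp: \<phi>_def \<psi>_def)
  have N_cont: "continuous_on {0..\<tau>} ?N"
    using u \<kappa>_pos by (intro continuous_on_nonlin) auto
  have damped_diff: "damped \<kappa> S \<tau> V - damped \<kappa> S \<tau> (u 0) = damped \<kappa> S \<tau> (V - u 0)"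
    using \<tau>_pos by (simp add: linear_diff[OF bounded_linear.linear[OF bounded_linear_damped]])
  have damped_e: "norm (damped \<kappa> S \<tau> (V - u 0)) \<le> (1 - \<kappa> * \<phi>) * e"
    using norm_damped_le[of \<tau> "V - u 0"] \<tau>_pos unfolding exp_phi1 by (simp add: e_def \<phi>_def)

  have P_err: "norm (?P - u \<tau>) \<le> (1 + a * \<phi>) * e + L * M * \<tau>\<^sup>2 / 2"
  proof -
    have eq: "?P - u \<tau> = damped \<kappa> S \<tau> (V - u 0) + duhamel \<kappa> S \<tau> (\<lambda>s. nonlin \<kappa> V - ?N s)"
      unfolding mild etd_predictor_duhamel
      using duhamel_diff[OF continuous_on_const N_cont, of "nonlin \<kappa> V"] damped_diff
      by (simp add: algebra_simps)
    have "norm (duhamel \<kappa> S \<tau> (\<lambda>s. nonlin \<kappa> V - ?N s)) \<le> L * e * \<phi> + L * M * \<tau> * \<psi>"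
      unfolding \<phi>_def \<psi>_def
    proof (intro norm_duhamel_le \<tau>_pos continuous_on_diff continuous_on_const N_cont)
      fix s assume s: "0 \<le> s" "s \<le> \<tau>"
      have "norm (nonlin \<kappa> V - ?N s) \<le> L * norm (V - u s)"
        using V u(2)[OF s] by (rule nonlin_lipschitz)
      also have "\<dots> \<le> L * (e + M * s)"
        using norm_triangle_ineq4[of "V - u 0" "u s - u 0"] lip[OF s] L
        by (intro mult_left_mono) (simp_all add: e_def)
      finally show "norm (nonlin \<kappa> V - ?N s) \<le> L * e + L * M * \<tau> * (s / \<tau>)"
        using \<tau>_pos by (simp add: algebra_simps)
    qed
    then have "norm (?P - u \<tau>) \<le> (1 - \<kappa> * \<phi>) * e + (L * e * \<phi> + L * M * \<tau> * \<psi>)"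
      unfolding eq by (intro norm_triangle_le add_mono damped_e)
    also have "\<dots> \<le> (1 - \<kappa> * \<phi>) * e + (L * e * \<phi> + L * M * \<tau> * (\<tau> / 2))"
      using \<psi> L M \<tau>_pos by (intro add_left_mono mult_left_mono) auto
    also have "\<dots> = (1 + a * \<phi>) * e + L * M * \<tau>\<^sup>2 / 2"
      by (simp add: La algebra_simps power2_eq_square)
    finally show ?thesis .
  qed

  \<comment> \<open>pass from u s to the point of the chord (Lipschitz bound), then interpolate along the chord\<close>
  have N_interp: "norm ((1 - s / \<tau>) *\<^sub>R nonlin \<kappa> (u 0) + (s / \<tau>) *\<^sub>R nonlin \<kappa> (u \<tau>) - ?N s) \<le> G * \<tau>\<^sup>2"
    if s: "0 \<le> s" "s \<le> \<tau>" for s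
  proof -
    let ?l = "(1 - s / \<tau>) *\<^sub>R u 0 + (s / \<tau>) *\<^sub>R u \<tau>"
    have \<theta>: "0 \<le> s / \<tau>" "s / \<tau> \<le> 1" using s \<tau>_pos by auto
    have l: "norm ?l \<le> sqrt m"
      using convexD[OF convex_cball, of "u 0" 0 "sqrt m" "u \<tau>" "1 - s / \<tau>" "s / \<tau>"] u0 u\<tau> \<theta>
      by simp
    have "norm ((1 - s / \<tau>) *\<^sub>R nonlin \<kappa> (u 0) + (s / \<tau>) *\<^sub>R nonlin \<kappa> (u \<tau>) - nonlin \<kappa> ?l)
        \<le> 5 * sqrt m * (norm (u \<tau> - u 0))\<^sup>2"
      using u0 u\<tau> \<theta> by (rule norm_nonlin_interpolation_le)
    also have "\<dots> \<le> 5 * sqrt m * (M * \<tau>)\<^sup>2"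
      using lip[of \<tau>] \<tau>_pos m_nonneg by (intro mult_left_mono power_mono) auto
    finally have "norm ((1 - s / \<tau>) *\<^sub>R nonlin \<kappa> (u 0) + (s / \<tau>) *\<^sub>R nonlin \<kappa> (u \<tau>) - nonlin \<kappa> ?l)
        \<le> 5 * sqrt m * (M * \<tau>)\<^sup>2" .
    moreover have "norm (?N s - nonlin \<kappa> ?l) \<le> L * (2 * M * \<tau>\<^sup>2)"
      using nonlin_lipschitz[OF u(2)[OF s] l] mult_left_mono[OF interp[OF s] L] by linarith
    ultimately show ?thesis
      using norm_triangle_ineq4[of
          "(1 - s / \<tau>) *\<^sub>R nonlin \<kappa> (u 0) + (s / \<tau>) *\<^sub>R nonlin \<kappa> (u \<tau>) - nonlin \<kappa> ?l"
          "?N s - nonlin \<kappa> ?l"]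
      by (simp add: G_def algebra_simps power_mult_distrib)
  qed

  let ?g = "\<lambda>s. (1 - s / \<tau>) *\<^sub>R nonlin \<kappa> V + (s / \<tau>) *\<^sub>R nonlin \<kappa> ?P"
  define p where "p = norm (?P - u \<tau>)"
  have g_cont: "continuous_on {0..\<tau>} ?g"
    using \<tau>_pos by (intro continuous_intros) auto
  have eq: "etdrk2_step \<kappa> S \<tau> V - u \<tau> =
      damped \<kappa> S \<tau> (V - u 0) + duhamel \<kappa> S \<tau> (\<lambda>s. ?g s - ?N s)"
    unfolding mild etdrk2_step_duhamel
    using duhamel_diff[OF g_cont N_cont] damped_diff by (simp add: algebra_simps)
  \<comment> \<open>the weights 1 - s / \<tau> and s / \<tau> are regrouped as a constant part and a part linear in s\<close>
  have "norm (duhamel \<kappa> S \<tau> (\<lambda>s. ?g s - ?N s)) \<le> (L * e + G * \<tau>\<^sup>2) * \<phi> + (L * p - L * e) * \<psi>"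
    unfolding \<phi>_def \<psi>_def
  proof (intro norm_duhamel_le \<tau>_pos continuous_on_diff g_cont N_cont)
    fix s assume s: "0 \<le> s" "s \<le> \<tau>"
    then have \<theta>: "0 \<le> s / \<tau>" "0 \<le> 1 - s / \<tau>" using \<tau>_pos by auto
    let ?A = "(1 - s / \<tau>) *\<^sub>R (nonlin \<kappa> V - nonlin \<kappa> (u 0))"
    let ?B = "(s / \<tau>) *\<^sub>R (nonlin \<kappa> ?P - nonlin \<kappa> (u \<tau>))"
    let ?C = "(1 - s / \<tau>) *\<^sub>R nonlin \<kappa> (u 0) + (s / \<tau>) *\<^sub>R nonlin \<kappa> (u \<tau>) - ?N s"
    have split: "?g s - ?N s = ?A + ?B + ?C"
      by (simp add: algebra_simps)
    have "norm (?g s - ?N s) \<le> norm ?A + norm ?B + norm ?C"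
      unfolding split by (intro norm_triangle_le add_right_mono norm_triangle_ineq)
    also have "\<dots> \<le> (1 - s / \<tau>) * (L * e) + (s / \<tau>) * (L * p) + G * \<tau>\<^sup>2"
    proof (intro add_mono N_interp s)
      show "norm ?A \<le> (1 - s / \<tau>) * (L * e)"
        using mult_left_mono[OF nonlin_lipschitz[OF V u0] \<theta>(2)] \<theta> by (simp add: e_def)
      show "norm ?B \<le> (s / \<tau>) * (L * p)"
        using mult_left_mono[OF nonlin_lipschitz[OF predictor_bound[OF V] u\<tau>] \<theta>(1)] s \<tau>_pos
        by (simp add: p_def)
    qed
    finally show "norm (?g s - ?N s) \<le> (L * e + G * \<tau>\<^sup>2) + (L * p - L * e) * (s / \<tau>)"
      by (simp add: algebra_simps)
  qed
  then have "norm (etdrk2_step \<kappa> S \<tau> V - u \<tau>)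
      \<le> (1 - \<kappa> * \<phi>) * e + ((L * e + G * \<tau>\<^sup>2) * \<phi> + (L * p - L * e) * \<psi>)"
    unfolding eq using damped_e norm_triangle_le add_mono by blast
  also have "\<dots> = (1 + a * \<phi>) * e + G * \<tau>\<^sup>2 * \<phi> + L * \<psi> * (p - e)"
    by (simp add: La algebra_simps)
  also have "\<dots> \<le> (1 + a * \<phi>) * e + G * \<tau>\<^sup>2 * \<tau> + L * \<psi> * (a * \<phi> * e + L * M * \<tau>\<^sup>2 / 2)"
  proof (rule add_mono[OF add_left_mono[OF mult_left_mono] mult_left_mono])
    show "p - e \<le> a * \<phi> * e + L * M * \<tau>\<^sup>2 / 2"
      using P_err by (simp add: p_def algebra_simps)
  qed (use \<phi> \<psi> L M m_nonneg in \<open>auto simp: G_def\<close>)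
  also have "\<dots> = (1 + a * \<phi> + L * \<psi> * (a * \<phi>)) * e + G * \<tau> ^ 3 + L\<^sup>2 * M * \<tau>\<^sup>2 / 2 * \<psi>"
    by (simp add: algebra_simps power2_eq_square power3_eq_cube)
  also have "\<dots> \<le> (1 + a * \<tau> + (a * \<tau>)\<^sup>2 / 2) * e + G * \<tau> ^ 3 + L\<^sup>2 * M * \<tau>\<^sup>2 / 2 * (\<tau> / 2)"
  proof (rule add_mono[OF add_right_mono[OF mult_right_mono] mult_left_mono])
    have "L * \<psi> * (a * \<phi>) = (\<kappa> * \<psi>) * (a * \<phi>) + a\<^sup>2 * (\<phi> * \<psi>)"
      by (simp add: La algebra_simps power2_eq_square)
    also have "\<kappa> * \<psi> = 1 - \<phi> / \<tau>"
      unfolding \<phi>_def \<psi>_def by (rule kappa_phi2)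
    finally have "a * \<phi> + L * \<psi> * (a * \<phi>) = a * (\<phi> * (2 - \<phi> / \<tau>)) + a\<^sup>2 * (\<phi> * \<psi>)"
      by (simp add: algebra_simps)
    also have "\<dots> \<le> a * \<tau> + a\<^sup>2 * (\<tau> * (\<tau> / 2))"
    proof (intro add_mono mult_left_mono)
      \<comment> \<open>the maximum of $\varphi(2\tau-\varphi)$ is attained at $\varphi=\tau$\<close>
      have "0 \<le> (\<tau> - \<phi>)\<^sup>2" by simp
      then have "\<phi> * (2 * \<tau> - \<phi>) \<le> \<tau> * \<tau>"
        by (simp add: power2_eq_square algebra_simps)
      then show "\<phi> * (2 - \<phi> / \<tau>) \<le> \<tau>"
        using \<tau>_pos by (simp add: field_simps)
      show "\<phi> * \<psi> \<le> \<tau> * (\<tau> / 2)"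
        using \<phi> \<psi> \<tau>_pos by (intro mult_mono) auto
    qed (use a in auto)
    finally show "1 + a * \<phi> + L * \<psi> * (a * \<phi>) \<le> 1 + a * \<tau> + (a * \<tau>)\<^sup>2 / 2"
      by (simp add: power2_eq_square algebra_simps)
  qed (use \<psi> M e in auto)
  finally show ?thesis
    by (simp add: e_def G_def algebra_simps power2_eq_square power3_eq_cube)
qed

lemma scheme_bound: "norm U0 \<le> sqrt m \<Longrightarrow> norm (etdrk2 \<kappa> S \<tau> U0 n) \<le> sqrt m"
  by (induction n) (auto simp: step_bound)

text \<open>
  The mild formulation is anchored at time \<open>0\<close>; the comparison over one step needs it anchored at \<open>t\<close>.
\<close>

lemma exact_solution_restart:
  assumes U: "exact_solution \<kappa> S T U0 U" and t: "0 \<le> t" "t + \<tau> \<le> T"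
  shows "U (t + \<tau>) = damped \<kappa> S \<tau> (U t) + duhamel \<kappa> S \<tau> (\<lambda>s. nonlin \<kappa> (U (t + s)))"
proof -
  have cont: "continuous_on {0..T} U" and bound: "\<And>s. s \<in> {0..T} \<Longrightarrow> norm (U s) \<le> sqrt m"
    and mild: "\<And>s. s \<in> {0..T} \<Longrightarrow> U s = damped \<kappa> S s U0 + duhamel \<kappa> S s (\<lambda>r. nonlin \<kappa> (U r))"
    using U unfolding exact_solution_def duhamel_def m_def by auto
  have "continuous_on {0..T} (\<lambda>s. nonlin \<kappa> (U s))"
    using cont bound \<kappa>_pos by (intro continuous_on_nonlin) auto
  then have N: "continuous_on {0..t + \<tau>} (\<lambda>s. nonlin \<kappa> (U s))"
    by (rule continuous_on_subset) (use t in auto)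
  interpret D: bounded_linear "damped \<kappa> S \<tau>"
    using \<tau>_pos by (intro bounded_linear_damped) simp
  have "U (t + \<tau>) = damped \<kappa> S (\<tau> + t) U0 + duhamel \<kappa> S (t + \<tau>) (\<lambda>r. nonlin \<kappa> (U r))"
    using t \<tau>_pos by (subst mild) (auto simp: add.commute)
  also have "\<dots> = damped \<kappa> S \<tau> (damped \<kappa> S t U0 + duhamel \<kappa> S t (\<lambda>r. nonlin \<kappa> (U r)))
      + duhamel \<kappa> S \<tau> (\<lambda>s. nonlin \<kappa> (U (t + s)))"
    using t \<tau>_pos duhamel_restart[OF _ t(1) N] damped_semigroup[of \<tau> t U0] by (simp add: D.add)
  also have "damped \<kappa> S t U0 + duhamel \<kappa> S t (\<lambda>r. nonlin \<kappa> (U r)) = U t"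
    using t \<tau>_pos by (subst mild[symmetric]) auto
  finally show ?thesis .
qed

text \<open>
  Induction on the number of steps, with $1+x+x^2/2\le e^x$ for the amplification factor.
\<close>

lemma global_error:
  assumes U0: "norm U0 \<le> sqrt m" and U: "exact_solution \<kappa> S T U0 U"
    and C2: "C2_in_time T U" and T: "0 < T" and M: "M = C2_norm T U"
    and n: "real n * \<tau> \<le> T"
  shows "norm (etdrk2 \<kappa> S \<tau> U0 n - U (real n * \<tau>))
    \<le> real n * ((L\<^sup>2 * M / 4 + 2 * L * M + 5 * sqrt m * M\<^sup>2) * \<tau> ^ 3) * exp (a * (real n * \<tau>))"
  using n
proof (induction n)
  case 0
  have "U 0 = U0"
    using U T unfolding exact_solution_def by (simp add: damped_def at_0)
  then show ?case by simp
next
  case (Suc n)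
  define t where "t = real n * \<tau>"
  define c where "c = (L\<^sup>2 * M / 4 + 2 * L * M + 5 * sqrt m * M\<^sup>2) * \<tau> ^ 3"
  define e where "e = norm (etdrk2 \<kappa> S \<tau> U0 n - U t)"
  have t: "0 \<le> t" "t + \<tau> \<le> T" and Suc_t: "real (Suc n) * \<tau> = t + \<tau>"
    using \<tau>_pos Suc.prems by (auto simp: t_def algebra_simps)
  have cont: "continuous_on {0..T} U" and bound: "\<And>s. s \<in> {0..T} \<Longrightarrow> norm (U s) \<le> sqrt m"
    using U unfolding exact_solution_def m_def by auto
  obtain U' where U': "\<And>t. t \<in> {0..T} \<Longrightarrow> (U has_vector_derivative U' t) (at t within {0..T})"
    and U'_le: "\<And>t. t \<in> {0..T} \<Longrightarrow> norm (U' t) \<le> M"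
    and U'_lip: "\<And>s t. s \<in> {0..T} \<Longrightarrow> t \<in> {0..T} \<Longrightarrow> norm (U' s - U' t) \<le> M * \<bar>s - t\<bar>"
    using C2_in_time_bounds[OF C2 T] unfolding M by blast
  have M0: "0 \<le> M"
    using U'_le[of 0] T norm_ge_zero order_trans by (meson atLeastAtMost_iff less_imp_le order_refl)
  have c0: "0 \<le> c" and a: "0 \<le> a"
    using \<kappa>_ge m_nonneg M0 \<tau>_pos by (auto simp: c_def L_def a_def)
  have "norm (etdrk2_step \<kappa> S \<tau> (etdrk2 \<kappa> S \<tau> U0 n) - U (t + \<tau>))
      \<le> (1 + a * \<tau> + (a * \<tau>)\<^sup>2 / 2) * norm (etdrk2 \<kappa> S \<tau> U0 n - U (t + 0)) + c"
    unfolding c_def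
  proof (rule one_step_error[where u = "\<lambda>s. U (t + s)"])
    show "norm (etdrk2 \<kappa> S \<tau> U0 n) \<le> sqrt m"
      using U0 by (rule scheme_bound)
    show "continuous_on {0..\<tau>} (\<lambda>s. U (t + s))"
      by (rule continuous_on_compose2[OF cont]) (use t in \<open>auto intro!: continuous_intros\<close>)
    show "U (t + \<tau>) = damped \<kappa> S \<tau> (U (t + 0)) + duhamel \<kappa> S \<tau> (\<lambda>s. nonlin \<kappa> (U (t + s)))"
      using exact_solution_restart[OF U t] by simp
    fix s assume s: "0 \<le> s" "s \<le> \<tau>"
    show "norm (U (t + s)) \<le> sqrt m"
      using s t by (intro bound) auto
    show "norm (U (t + s) - U (t + 0)) \<le> M * s"
      using vector_derivative_bound[OF U' U'_le, of "t + s" t] s t by auto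
    show "norm (U (t + s) - ((1 - s / \<tau>) *\<^sub>R U (t + 0) + (s / \<tau>) *\<^sub>R U (t + \<tau>))) \<le> 2 * M * \<tau>\<^sup>2"
      using linear_interpolation_error[OF U' U'_lip s \<tau>_pos t M0] by simp
  qed (rule M0)
  then have "norm (etdrk2 \<kappa> S \<tau> U0 (Suc n) - U (t + \<tau>)) \<le> (1 + a * \<tau> + (a * \<tau>)\<^sup>2 / 2) * e + c"
    by (simp add: e_def)
  also have "\<dots> \<le> exp (a * \<tau>) * e + c * 1"
    using exp_lower_Taylor_quadratic[of "a * \<tau>"] a \<tau>_pos
    by (intro add_mono mult_right_mono) (auto simp: e_def)
  also have "\<dots> \<le> exp (a * \<tau>) * (real n * c * exp (a * t)) + c * exp (a * (t + \<tau>))"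
    using Suc.IH t \<tau>_pos c0 a unfolding t_def[symmetric] c_def[symmetric] e_def[symmetric]
    by (intro add_mono mult_left_mono) auto
  also have "\<dots> = real (Suc n) * c * exp (a * (t + \<tau>))"
    by (simp add: algebra_simps exp_add)
  finally show ?case
    unfolding Suc_t c_def .
qed

end

lemma heat_semigroup_contraction:
  assumes "heat_semigroup \<epsilon> S" and "0 < \<kappa>"
  shows "contraction_semigroup S \<kappa>"
proof -
  interpret strongly_continuous S
    using assms(1) by unfold_locales (simp add: heat_semigroup_def)
  show ?thesis
    using assms contraction generator_dissipative by unfold_locales blast+
qed

theorem theorem3p6:
  fixes \<kappa> :: real
  assumes "2 \<le> CARD('n::finite)"
    and "max (3 / 2 * real CARD('n) - 1) 2 \<le> \<kappa>"
  shows "\<exists>C :: real \<Rightarrow> real \<Rightarrow> real.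
    \<forall>\<epsilon> S T (U0 :: 'n per_field) U.
      \<epsilon> > 0 \<longrightarrow> heat_semigroup \<epsilon> S \<longrightarrow> T > 0 \<longrightarrow>
      norm U0 \<le> sqrt (real CARD('n)) \<longrightarrow>
      exact_solution \<kappa> S T U0 U \<longrightarrow> C2_in_time T U \<longrightarrow>
      (\<forall>\<tau> n. \<tau> > 0 \<longrightarrow> real n * \<tau> \<le> T \<longrightarrow>
        norm (etdrk2 \<kappa> S \<tau> U0 n - U (real n * \<tau>))
          \<le> C (real n * \<tau>) (C2_norm T U) *
             exp ((1 + 5 * real CARD('n)) * (real n * \<tau>)) * \<tau>\<^sup>2)"
proof -
  define m where "m = real CARD('n)"
  define c where "c M = (\<kappa> + 1 + 3 * m)\<^sup>2 * M / 4 + 2 * (\<kappa> + 1 + 3 * m) * M + 5 * sqrt m * M\<^sup>2" for M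
  show ?thesis
  proof (intro exI[of _ "\<lambda>t M. t * \<bar>c M\<bar>"] allI impI)
    fix \<epsilon> S T and U0 :: "'n per_field" and U and \<tau> :: real and n :: nat
    assume heat: "heat_semigroup \<epsilon> S" and T: "T > 0" and U0: "norm U0 \<le> sqrt (real CARD('n))"
      and U: "exact_solution \<kappa> S T U0 U" and C2: "C2_in_time T U"
      and \<tau>: "\<tau> > 0" and n: "real n * \<tau> \<le> T"
    interpret contraction_semigroup S \<kappa>
      using heat assms(2) by (intro heat_semigroup_contraction) auto
    interpret etdrk2_setting S \<kappa> m \<tau>
      using assms \<tau> by unfold_locales (auto simp: m_def)
    define t where "t = real n * \<tau>"
    have t: "0 \<le> t" using \<tau> by (simp add: t_def)
    have "norm (etdrk2 \<kappa> S \<tau> U0 n - U t)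
        \<le> real n * (c (C2_norm T U) * \<tau> ^ 3) * exp ((1 + 3 * m) * t)"
      using global_error[OF U0[folded m_def] U C2 T refl n]
      unfolding t_def c_def L_def a_def .
    also have "\<dots> = t * c (C2_norm T U) * \<tau>\<^sup>2 * exp ((1 + 3 * m) * t)"
      by (simp add: t_def power2_eq_square power3_eq_cube)
    also have "\<dots> \<le> t * \<bar>c (C2_norm T U)\<bar> * \<tau>\<^sup>2 * exp ((1 + 5 * m) * t)"
    proof (rule mult_mono)
      \<comment> \<open>the absolute value makes the constant nonnegative, as monotonicity in the exponent requires\<close>
      show "t * c (C2_norm T U) * \<tau>\<^sup>2 \<le> t * \<bar>c (C2_norm T U)\<bar> * \<tau>\<^sup>2"
        using t by (intro mult_right_mono mult_left_mono) auto
      have "(1 + 3 * m) * t \<le> (1 + 5 * m) * t"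
        using t by (intro mult_right_mono) (auto simp: m_def)
      then show "exp ((1 + 3 * m) * t) \<le> exp ((1 + 5 * m) * t)"
        by simp
    qed (use t in auto)
    finally show "norm (etdrk2 \<kappa> S \<tau> U0 n - U (real n * \<tau>))
        \<le> real n * \<tau> * \<bar>c (C2_norm T U)\<bar> * exp ((1 + 5 * real CARD('n)) * (real n * \<tau>)) * \<tau>\<^sup>2"
      by (simp add: t_def m_def mult_ac)
  qed
qed

end
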